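(* Let $M$ be a $C^{\infty}$ smooth paracompact manifold without boundary, let $1\leq r\leq\infty$, and let $G\leq \mathrm{Diff}^r_c(M)_0$ be a group of diffeomorphisms of $M$ which is isotopically connected, non-fixing and factorizable. Then the commutator group $[G,G]$ is simple if and only if the foliation $\mathcal{F}_{[G,G]}$ determined by $[G,G]$ admits no proper (i.e. not equal to $M$) minimal set.
   Context: Isotopies: a $C^r$ isotopy is a $C^r$ map $\mathbb{R}\times M\to M$, $(t,x)\mapsto f_t(x)$, with each $f_t$ a $C^r$ diffeomorphism of $M$ and $f_0=\mathrm{id}$; it joins $f=f_1$ to the identity. It is compactly supported if there is a compact set outside of which all $f_t$ are the identity. $\mathrm{Diff}^r(M)$ is the group of all $C^r$ diffeomorphisms of $M$, and $\mathrm{Diff}^r_c(M)_0$ is the subgroup of those diffeomorphisms that can be joined to the identity by a compactly supported $C^r$ isotopy on $M$. A group $G\leq\mathrm{Diff}^r(M)$ is isotopically connected if every $f\in G$ can be joined to $\mathrm{id}_M$ by a $C^r$ isotopy $f_t$ with $f_t\in G$ for all $t$ (such an isotopy is called an isotopy in $G$). $G$ is non-fixing if $G(x)\neq\{x\}$ for every $x\in M$, where $G(x)$ is the orbit of $x$. For $U\subset M$, $G_U$ denotes the identity component of the group of all diffeomorphisms from $G$ compactly supported in $U$, i.e. the elements that can be joined to the identity by a $C^r$ isotopy in that group. $G$ is factorizable if for every open cover $\mathcal{U}$ of $M$ and every $g\in G$ there are $g_1,\ldots,g_s\in G$ with $g=g_1\cdots g_s$ and $g_i\in G_{U_i}$,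 $i=1,\ldots,s$, for some $U_1,\ldots,U_s\in\mathcal{U}$. Foliation determined by a group: for an isotopically connected group $H\leq\mathrm{Diff}^r(M)$, $\mathcal{F}_H$ is the (singular, Sussmann–Stefan) foliation of $M$ whose leaves are the accessible sets of the isotopies in $H$: the leaf through $x$ is the set of all points obtained from $x$ by finite compositions of maps $f_t$ and $f_t^{-1}$, where $(f_t)$ ranges over isotopies in $H$ and $t\in\mathbb{R}$; it equals the orbit $H(x)$. If $H$ is an arbitrary subgroup, $\mathcal{F}_H$ means $\mathcal{F}_{H_0}$, where $H_0$ is the maximal isotopically connected subgroup of $H$. Minimal sets: a subset of $M$ is saturated if it is a union of leaves. Convention: the statement that a foliation admits no proper minimal set means that all its leaves are dense in $M$, equivalently that there is no closed saturated subset $L$ with $\emptyset\neq L\subsetneq M$. *)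

theory Defs
  imports "HOL-Analysis.Analysis" "HOL-Library.Extended_Nat" "HOL-Algebra.Generated_Groups"
begin

text \<open>
  A manifold is a type \<open>'m\<close> (a Hausdorff space) together with an atlas \<open>A\<close>, a set of pairs
  \<open>(U, \<phi>)\<close>, where the values of \<open>\<phi>\<close> outside the open set \<open>U\<close> are irrelevant.
\<close>

section \<open>Maps of class \<open>C\<^sup>r\<close>\<close>

text \<open>On an open subset \<open>S\<close> of a Euclidean space: all iterated directional derivatives of order at
  most \<open>n\<close> exist as Frechet derivatives and are continuous.\<close>

primrec C_nat_on ::
    "'a::euclidean_space set \<Rightarrow> nat \<Rightarrow> ('a \<Rightarrow> 'b::euclidean_space) \<Rightarrow> bool" where
  "C_nat_on S 0 f \<longleftrightarrow> continuous_on S f"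
| "C_nat_on S (Suc n) f \<longleftrightarrow>
     (\<forall>x\<in>S. f differentiable (at x)) \<and>
     (\<forall>v. C_nat_on S n (\<lambda>x. frechet_derivative f (at x) v))"

definition C_on ::
    "enat \<Rightarrow> 'a::euclidean_space set \<Rightarrow> ('a \<Rightarrow> 'b::euclidean_space) \<Rightarrow> bool" where
  "C_on r S f \<longleftrightarrow> (\<forall>n. enat n \<le> r \<longrightarrow> C_nat_on S n f)"

type_synonym ('m, 'e) atlas = "('m set \<times> ('m \<Rightarrow> 'e)) set"

definition smooth_manifold ::
    "('m::t2_space, 'e::euclidean_space) atlas \<Rightarrow> bool" where
  "smooth_manifold A \<longleftrightarrow>
     (\<Union>(U, \<phi>)\<in>A. U) = UNIV \<and>
     (\<forall>(U, \<phi>)\<in>A. open U \<and> open (\<phi> ` U) \<and> homeomorphism U (\<phi> ` U) \<phi> (inv_into U \<phi>)) \<and>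
     (\<forall>(U, \<phi>)\<in>A. \<forall>(V, \<psi>)\<in>A. C_on \<infinity> (\<phi> ` (U \<inter> V)) (\<psi> \<circ> inv_into U \<phi>))"

definition paracompact_space :: "'a topology \<Rightarrow> bool" where
  "paracompact_space X \<longleftrightarrow>
     (\<forall>\<U>. (\<forall>U\<in>\<U>. openin X U) \<and> \<Union>\<U> = topspace X \<longrightarrow>
       (\<exists>\<V>. (\<forall>V\<in>\<V>. openin X V \<and> (\<exists>U\<in>\<U>. V \<subseteq> U)) \<and> \<Union>\<V> = topspace X \<and>
            locally_finite_in X \<V>))"

definition C_map ::
    "enat \<Rightarrow> ('a::t2_space, 'd::euclidean_space) atlas \<Rightarrow>
      ('b::t2_space, 'e::euclidean_space) atlas \<Rightarrow> ('a \<Rightarrow> 'b) \<Rightarrow> bool" where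
  "C_map r A B f \<longleftrightarrow>
     continuous_on UNIV f \<and>
     (\<forall>(U, \<phi>)\<in>A. \<forall>(V, \<psi>)\<in>B. C_on r (\<phi> ` (U \<inter> f -` V)) (\<psi> \<circ> f \<circ> inv_into U \<phi>))"

definition standard_atlas :: "('e::euclidean_space, 'e) atlas" where
  "standard_atlas = {(UNIV, id)}"

definition prod_atlas ::
    "('a, 'd) atlas \<Rightarrow> ('b, 'e) atlas \<Rightarrow> ('a \<times> 'b, 'd \<times> 'e) atlas" where
  "prod_atlas A B = {(U \<times> V, map_prod \<phi> \<psi>) | U \<phi> V \<psi>. (U, \<phi>) \<in> A \<and> (V, \<psi>) \<in> B}"

section \<open>Diffeomorphism groups and isotopies\<close>

definition C_diffeo ::
    "enat \<Rightarrow> ('m::t2_space, 'e::euclidean_space) atlas \<Rightarrow> ('m \<Rightarrow> 'm) \<Rightarrow> bool" where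
  "C_diffeo r A f \<longleftrightarrow> bij f \<and> C_map r A A f \<and> C_map r A A (inv_into UNIV f)"

definition Diff ::
    "enat \<Rightarrow> ('m::t2_space, 'e::euclidean_space) atlas \<Rightarrow> ('m \<Rightarrow> 'm) monoid" where
  "Diff r A = \<lparr>carrier = {f. C_diffeo r A f}, mult = (\<circ>), one = id\<rparr>"

definition isotopy ::
    "enat \<Rightarrow> ('m::t2_space, 'e::euclidean_space) atlas \<Rightarrow> (real \<Rightarrow> 'm \<Rightarrow> 'm) \<Rightarrow> bool" where
  "isotopy r A F \<longleftrightarrow>
     C_map r (prod_atlas standard_atlas A) A (\<lambda>(t, x). F t x) \<and>
     (\<forall>t. C_diffeo r A (F t)) \<and> F 0 = id"

definition compactly_supported :: "(real \<Rightarrow> 'm::t2_space \<Rightarrow> 'm) \<Rightarrow> bool" where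
  "compactly_supported F \<longleftrightarrow> (\<exists>K. compact K \<and> (\<forall>t. \<forall>x. x \<notin> K \<longrightarrow> F t x = x))"

definition Diff_c_0 ::
    "enat \<Rightarrow> ('m::t2_space, 'e::euclidean_space) atlas \<Rightarrow> ('m \<Rightarrow> 'm) set" where
  "Diff_c_0 r A = {f. \<exists>F. isotopy r A F \<and> compactly_supported F \<and> F 1 = f}"

definition isotopy_in ::
    "enat \<Rightarrow> ('m::t2_space, 'e::euclidean_space) atlas \<Rightarrow> ('m \<Rightarrow> 'm) set \<Rightarrow>
      (real \<Rightarrow> 'm \<Rightarrow> 'm) \<Rightarrow> bool" where
  "isotopy_in r A G F \<longleftrightarrow> isotopy r A F \<and> (\<forall>t. F t \<in> G)"

definition identity_component ::
    "enat \<Rightarrow> ('m::t2_space, 'e::euclidean_space) atlas \<Rightarrow> ('m \<Rightarrow> 'm) set \<Rightarrow> ('m \<Rightarrow> 'm) set" where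
  "identity_component r A G = {f. \<exists>F. isotopy_in r A G F \<and> F 1 = f}"

definition isotopically_connected ::
    "enat \<Rightarrow> ('m::t2_space, 'e::euclidean_space) atlas \<Rightarrow> ('m \<Rightarrow> 'm) set \<Rightarrow> bool" where
  "isotopically_connected r A G \<longleftrightarrow> (\<forall>f\<in>G. \<exists>F. isotopy_in r A G F \<and> F 1 = f)"

definition non_fixing :: "('m \<Rightarrow> 'm) set \<Rightarrow> bool" where
  "non_fixing G \<longleftrightarrow> (\<forall>x. (\<lambda>g. g x) ` G \<noteq> {x})"

definition supp :: "('m::t2_space \<Rightarrow> 'm) \<Rightarrow> 'm set" where
  "supp f = closure {x. f x \<noteq> x}"

text \<open>The group \<open>G\<^sub>U\<close>: the isotopy is required to consist of elements of \<open>G\<close> each having compact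
  support in \<open>U\<close>; no common compact set is prescribed.\<close>

definition supported_component ::
    "enat \<Rightarrow> ('m::t2_space, 'e::euclidean_space) atlas \<Rightarrow> ('m \<Rightarrow> 'm) set \<Rightarrow> 'm set \<Rightarrow>
      ('m \<Rightarrow> 'm) set" where
  "supported_component r A G U =
     identity_component r A {g \<in> G. compact (supp g) \<and> supp g \<subseteq> U}"

definition factorizable ::
    "enat \<Rightarrow> ('m::t2_space, 'e::euclidean_space) atlas \<Rightarrow> ('m \<Rightarrow> 'm) set \<Rightarrow> bool" where
  "factorizable r A G \<longleftrightarrow>
     (\<forall>\<U>. (\<forall>U\<in>\<U>. open U) \<and> \<Union>\<U> = UNIV \<longrightarrow>
       (\<forall>g\<in>G. \<exists>gs. g = foldr (\<circ>) gs id \<and>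
          (\<forall>h\<in>set gs. h \<in> G \<and> (\<exists>U\<in>\<U>. h \<in> supported_component r A G U))))"

text \<open>The locale \<open>simple_group\<close> of \<open>HOL-Algebra.SimpleGroups\<close> requires \<open>order G > 1\<close>, which is
  false for every infinite group (as \<open>order\<close> is then 0); hence this version.\<close>

definition simple :: "('a, 'b) monoid_scheme \<Rightarrow> bool" where
  "simple G \<longleftrightarrow> group G \<and> carrier G \<noteq> {\<one>\<^bsub>G\<^esub>} \<and>
     (\<forall>N. N \<lhd> G \<longrightarrow> N = carrier G \<or> N = {\<one>\<^bsub>G\<^esub>})"

section \<open>The foliation determined by a group\<close>

inductive_set accessible ::
    "enat \<Rightarrow> ('m::t2_space, 'e::euclidean_space) atlas \<Rightarrow> ('m \<Rightarrow> 'm) set \<Rightarrow> 'm \<Rightarrow> 'm set"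
  for r :: enat and A :: "('m, 'e) atlas" and H :: "('m \<Rightarrow> 'm) set" and x :: 'm where
  start: "x \<in> accessible r A H x"
| forward: "y \<in> accessible r A H x \<Longrightarrow> isotopy_in r A H F \<Longrightarrow> F t y \<in> accessible r A H x"
| backward: "y \<in> accessible r A H x \<Longrightarrow> isotopy_in r A H F \<Longrightarrow>
    inv_into UNIV (F t) y \<in> accessible r A H x"

definition maximal_isotopically_connected ::
    "enat \<Rightarrow> ('m::t2_space, 'e::euclidean_space) atlas \<Rightarrow> ('m \<Rightarrow> 'm) set \<Rightarrow> ('m \<Rightarrow> 'm) set" where
  "maximal_isotopically_connected r A H =
     (GREATEST K. subgroup K (Diff r A) \<and> K \<subseteq> H \<and> isotopically_connected r A K)"

text \<open>A foliation is represented by its set of leaves, the leaves being plain point sets.\<close>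

definition foliation ::
    "enat \<Rightarrow> ('m::t2_space, 'e::euclidean_space) atlas \<Rightarrow> ('m \<Rightarrow> 'm) set \<Rightarrow> 'm set set" where
  "foliation r A H = range (accessible r A (maximal_isotopically_connected r A H))"

definition saturated :: "'m set set \<Rightarrow> 'm set \<Rightarrow> bool" where
  "saturated \<F> S \<longleftrightarrow> (\<exists>\<L>\<subseteq>\<F>. S = \<Union>\<L>)"

definition no_proper_minimal_set :: "'m::topological_space set set \<Rightarrow> bool" where
  "no_proper_minimal_set \<F> \<longleftrightarrow> (\<forall>L\<in>\<F>. closure L = UNIV)"

lemma accessible_closure:
  assumes "z \<in> accessible r A H y" "y \<in> closure (accessible r A H x)"
  shows "z \<in> closure (accessible r A H x)"
  using assms
proof induction
  case (forward y F t)
  have "continuous_on UNIV (F t)"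
    using forward by (auto simp: isotopy_in_def isotopy_def C_diffeo_def C_map_def)
  then have "F t ` closure (accessible r A H x) \<subseteq> closure (F t ` accessible r A H x)"
    by (intro image_closure_subset[OF _ closed_closure closure_subset])
      (auto intro: continuous_on_subset)
  also have "\<dots> \<subseteq> closure (accessible r A H x)"
    using forward by (intro closure_mono) (auto intro: accessible.intros)
  finally show ?case using forward by blast
next
  case (backward y F t)
  have "continuous_on UNIV (inv_into UNIV (F t))"
    using backward by (auto simp: isotopy_in_def isotopy_def C_diffeo_def C_map_def)
  then have "inv_into UNIV (F t) ` closure (accessible r A H x)
      \<subseteq> closure (inv_into UNIV (F t) ` accessible r A H x)"
    by (intro image_closure_subset[OF _ closed_closure closure_subset])
      (auto intro: continuous_on_subset)
  also have "\<dots> \<subseteq> closure (accessible r A H x)"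
    using backward by (intro closure_mono) (auto intro: accessible.intros)
  finally show ?case using backward by blast
qed auto

lemma no_proper_minimal_set_foliation_iff:
  "no_proper_minimal_set (foliation r A H) \<longleftrightarrow>
     \<not> (\<exists>L. closed L \<and> saturated (foliation r A H) L \<and> L \<noteq> {} \<and> L \<noteq> UNIV)"
proof -
  define leaf where "leaf = accessible r A (maximal_isotopically_connected r A H)"
  have fol: "foliation r A H = range leaf"
    by (simp add: foliation_def leaf_def)
  have sat: "saturated (range leaf) (closure (leaf x))" for x
  proof -
    have "closure (leaf x) = \<Union> (leaf ` closure (leaf x))"
    proof
      show "closure (leaf x) \<subseteq> \<Union> (leaf ` closure (leaf x))"
        unfolding leaf_def by (auto intro: accessible.start)
      show "\<Union> (leaf ` closure (leaf x)) \<subseteq> closure (leaf x)"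
        unfolding leaf_def by (auto intro: accessible_closure)
    qed
    then show ?thesis
      unfolding saturated_def by (intro exI[of _ "leaf ` closure (leaf x)"]) auto
  qed
  have nonempty: "closure (leaf x) \<noteq> {}" for x
    using accessible.start[of x] unfolding leaf_def by auto
  have full: "L = UNIV"
    if dense: "\<forall>x. closure (leaf x) = UNIV" and L: "closed L" "saturated (range leaf) L" "L \<noteq> {}"
    for L
  proof -
    obtain \<L> where \<L>: "\<L> \<subseteq> range leaf" "L = \<Union>\<L>"
      using L(2) unfolding saturated_def by auto
    with L(3) obtain S where S: "S \<in> \<L>" by auto
    with \<L>(1) have "S \<in> range leaf" by (rule subsetD)
    then obtain x where x: "S = leaf x" by (rule rangeE)
    have "leaf x \<subseteq> L"
      unfolding \<L>(2) x[symmetric] using S by (rule Union_upper)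
    then have "closure (leaf x) \<subseteq> L" using L(1) by (rule closure_minimal)
    then show ?thesis using dense by auto
  qed
  show ?thesis
    unfolding no_proper_minimal_set_def fol
  proof
    assume "\<forall>L\<in>range leaf. closure L = UNIV"
    then have "\<forall>x. closure (leaf x) = UNIV" by simp
    from full[OF this]
    show "\<not> (\<exists>L. closed L \<and> saturated (range leaf) L \<and> L \<noteq> {} \<and> L \<noteq> UNIV)"
      by blast
  next
    assume *: "\<not> (\<exists>L. closed L \<and> saturated (range leaf) L \<and> L \<noteq> {} \<and> L \<noteq> UNIV)"
    have "closure (leaf x) = UNIV" for x
      using * sat[of x] nonempty[of x] closed_closure[of "leaf x"] by (metis (no_types))
    then show "\<forall>L\<in>range leaf. closure L = UNIV" by simp
  qed
qed

end

theory Submission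
  imports Defs
begin

text \<open>
  Write \<open>D = [G, G]\<close>. Since pointwise products and inverses of isotopies are isotopies, \<open>D\<close> is
  isotopically connected, so its leaves are its orbits. Factorizing an element over the cover
  \<open>{V, M - {y}}\<close> shows that elements of \<open>G\<close> supported near \<open>y\<close> move \<open>y\<close>.

  If some orbit closure \<open>L\<close> is proper, the elements of \<open>D\<close> that fix \<open>L\<close> pointwise form a normal
  subgroup; it is proper because \<open>D\<close> has no fixed point, and nontrivial because it contains
  commutators of elements supported off \<open>L\<close>.

  Conversely let the orbits of \<open>D\<close> be dense and let \<open>n \<noteq> id\<close> lie in a normal subgroup \<open>N\<close> of \<open>D\<close>.
  If \<open>U\<close> is a small neighbourhood of a point moved by \<open>n\<close>, then \<open>N\<close> contains all commutators of
  elements supported in \<open>U\<close>, hence all commutators of elements supported in a translate of \<open>U\<close> by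
  \<open>D\<close>. By density the translates cover \<open>M\<close>, and by factorizability over a star refinement of this
  cover, \<open>D\<close> is generated by \<open>G\<close>-conjugates of such commutators. These conjugates are already
  \<open>D\<close>-conjugates, because factors whose support meets a small set can be displaced from it modulo
  \<open>D\<close>. Hence \<open>D \<subseteq> N\<close>.
\<close>

unbundle no m_inv_syntax

section \<open>Barycentric refinements\<close>

text \<open>Cover the space by \<open>V\<close> and the open sets whose closure misses
  \<open>x\<close>; by the Hausdorff property the latter reach every point outside \<open>V\<close>.
  In a locally finite refinement the closures of the members not inside \<open>V\<close> have a
  closed union that misses \<open>x\<close>, and its complement is the required
  neighbourhood.\<close>

lemma paracompact_t2_regular:
  fixes x :: "'a::t2_space"
  assumes "paracompact_space (euclidean :: 'a topology)" "open V" "x \<in> V"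
  obtains W where "open W" "x \<in> W" "closure W \<subseteq> V"
proof -
  define \<U> where "\<U> = insert V {W. open W \<and> x \<notin> closure W}"
  have "y \<in> \<Union>\<U>" for y
  proof (cases "y \<in> V")
    case False
    then have "x \<noteq> y" using assms by auto
    then obtain X W where "open X" "open W" "x \<in> X" "y \<in> W" "X \<inter> W = {}"
      by (meson hausdorff)
    then have "W \<in> \<U>" unfolding \<U>_def
      using open_Int_closure_eq_empty[of X W] by auto
    then show ?thesis using \<open>y \<in> W\<close> by auto
  qed (auto simp: \<U>_def)
  moreover have "\<forall>U\<in>\<U>. open U" using assms by (auto simp: \<U>_def)
  ultimately obtain \<T> where \<T>: "\<forall>T\<in>\<T>. open T \<and> (\<exists>U\<in>\<U>. T \<subseteq> U)" "\<Union>\<T> = UNIV"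
    "locally_finite_in (euclidean :: 'a topology) \<T>"
    using assms(1) unfolding paracompact_space_def
    by (metis UNIV_eq_I open_openin topspace_euclidean)
  define \<S> where "\<S> = {T\<in>\<T>. \<not> T \<subseteq> V}"
  have fin: "locally_finite_in (euclidean :: 'a topology) \<S>"
    using \<T>(3) by (rule locally_finite_in_subset) (auto simp: \<S>_def)
  have closed: "closed (\<Union>(closure ` \<S>))"
    using closedin_Union_locally_finite_closure[OF fin] by simp
  have "x \<notin> closure T" if "T \<in> \<S>" for T
  proof -
    have "T \<in> \<T>" using that by (simp add: \<S>_def)
    with \<T>(1) obtain U where "U \<in> \<U>" "T \<subseteq> U" by (elim ballE) auto
    then show ?thesis using that closure_mono[of T U] unfolding \<S>_def \<U>_def by blast
  qed
  then have x: "x \<in> - \<Union>(closure ` \<S>)" by auto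
  \<comment> \<open>The complement of the open set \<open>\<Union>\<S>\<close> is closed, so it
    contains the closure in question; each of its points is covered by a member of
    \<open>\<T>\<close> inside \<open>V\<close>.\<close>
  have "open (\<Union>\<S>)" using \<T>(1) by (auto simp: \<S>_def)
  moreover have "- \<Union>(closure ` \<S>) \<subseteq> - \<Union>\<S>" using closure_subset by blast
  ultimately have "closure (- \<Union>(closure ` \<S>)) \<subseteq> - \<Union>\<S>"
    by (meson closed_Compl closure_minimal)
  also have "\<dots> \<subseteq> V"
  proof
    fix y assume "y \<in> - \<Union>\<S>"
    moreover have "y \<in> \<Union>\<T>" by (simp add: \<T>(2))
    then obtain T where "T \<in> \<T>" "y \<in> T" by (rule UnionE)
    ultimately show "y \<in> V" unfolding \<S>_def by blast
  qed
  finally show ?thesis using that[of "- \<Union>(closure ` \<S>)"] x closed open_Compl by blast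
qed

text \<open>Regularity gives a locally finite cover \<open>\<T>\<close> with each
  \<open>closure T\<close> inside some \<open>v T\<close> from \<open>\<V>\<close>. The
  neighbourhood \<open>B x\<close> is cut down so that it meets \<open>T\<close> only if
  \<open>x\<close> lies in \<open>closure T\<close>, and then it lies in \<open>v T\<close>. Hence
  all the sets \<open>B x\<close> through a point of \<open>T\<close> lie in the one set
  \<open>v T\<close>.\<close>

lemma paracompact_t2_barycentric_refinement:
  fixes \<V> :: "'a::t2_space set set"
  assumes para: "paracompact_space (euclidean :: 'a topology)"
    and \<V>: "\<And>V. V \<in> \<V> \<Longrightarrow> open V" "\<Union>\<V> = UNIV"
  obtains \<W> where "\<forall>W\<in>\<W>. open W" "\<Union>\<W> = UNIV"
    "\<forall>y. \<exists>V\<in>\<V>. \<forall>W\<in>\<W>. y \<in> W \<longrightarrow> W \<subseteq> V"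
proof -
  define \<U> where "\<U> = {U. open U \<and> (\<exists>V\<in>\<V>. closure U \<subseteq> V)}"
  have "y \<in> \<Union>\<U>" for y
  proof -
    have "y \<in> \<Union>\<V>" by (simp add: \<V>(2))
    then obtain V where V: "V \<in> \<V>" "y \<in> V" by (rule UnionE)
    from paracompact_t2_regular[OF para \<V>(1)[OF V(1)] V(2)]
    obtain W where "open W" "y \<in> W" "closure W \<subseteq> V" .
    then show ?thesis using V unfolding \<U>_def by blast
  qed
  moreover have "\<forall>U\<in>\<U>. open U" by (auto simp: \<U>_def)
  ultimately obtain \<T> where \<T>: "\<forall>T\<in>\<T>. open T \<and> (\<exists>U\<in>\<U>. T \<subseteq> U)" "\<Union>\<T> = UNIV"
    "locally_finite_in (euclidean :: 'a topology) \<T>"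
    using para unfolding paracompact_space_def
    by (metis UNIV_eq_I open_openin topspace_euclidean)
  have "\<exists>V\<in>\<V>. closure T \<subseteq> V" if T: "T \<in> \<T>" for T
  proof -
    obtain U where U: "U \<in> \<U>" "T \<subseteq> U" using bspec[OF \<T>(1) T] by blast
    then obtain V where "V \<in> \<V>" "closure U \<subseteq> V" unfolding \<U>_def by blast
    then show ?thesis using closure_mono[OF U(2)] by blast
  qed
  then obtain v where v: "\<And>T. T \<in> \<T> \<Longrightarrow> v T \<in> \<V>" "\<And>T. T \<in> \<T> \<Longrightarrow> closure T \<subseteq> v T"
    by metis
  define B where "B x = (\<Inter>T\<in>{T\<in>\<T>. x \<in> closure T}. v T) - \<Union>(closure ` {T\<in>\<T>. x \<notin> closure T})" for x
  show ?thesis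
  proof (rule that[of "range B"]; (intro ballI allI)?)
    fix W assume "W \<in> range B"
    then obtain x where W: "W = B x" by auto
    \<comment> \<open>Local finiteness makes the intersection in \<open>B x\<close> finite and the
      removed union of closures closed.\<close>
    obtain O' where O': "open O'" "x \<in> O'" "finite {T\<in>\<T>. T \<inter> O' \<noteq> {}}"
      using \<T>(3) unfolding locally_finite_in_def by (auto simp flip: open_openin)
    have "{T\<in>\<T>. x \<in> closure T} \<subseteq> {T\<in>\<T>. T \<inter> O' \<noteq> {}}"
      using O' by (auto simp: closure_iff_nhds_not_empty)
    then have "finite {T\<in>\<T>. x \<in> closure T}" using O'(3) finite_subset by blast
    then have "open (\<Inter>T\<in>{T\<in>\<T>. x \<in> closure T}. v T)"
      using v(1) \<V>(1) by (intro open_INT) auto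
    moreover have "locally_finite_in (euclidean :: 'a topology) {T\<in>\<T>. x \<notin> closure T}"
      using \<T>(3) by (rule locally_finite_in_subset) auto
    from closedin_Union_locally_finite_closure[OF this]
    have "closed (\<Union>(closure ` {T\<in>\<T>. x \<notin> closure T}))" by simp
    ultimately show "open W" unfolding W B_def by (rule open_Diff)
  next
    have "x \<in> B x" for x using v(2) by (auto simp: B_def)
    then show "\<Union>(range B) = UNIV" by blast
  next
    fix y
    have "y \<in> \<Union>\<T>" by (simp add: \<T>(2))
    then obtain T where T: "T \<in> \<T>" "y \<in> T" by (rule UnionE)
    have "B x \<subseteq> v T" if "y \<in> B x" for x
    proof -
      have "x \<in> closure T" using that T closure_subset[of T] by (auto simp: B_def)
      then show ?thesis using T by (auto simp: B_def)
    qed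
    then show "\<exists>V\<in>\<V>. \<forall>W\<in>range B. y \<in> W \<longrightarrow> W \<subseteq> V" using v(1)[OF T(1)] by auto
  qed
qed

section \<open>Factorizable groups of homeomorphisms\<close>

definition commutator :: "('a \<Rightarrow> 'a) \<Rightarrow> ('a \<Rightarrow> 'a) \<Rightarrow> 'a \<Rightarrow> 'a" where
  "commutator f g = f \<circ> g \<circ> inv f \<circ> inv g"

text \<open>The moved points themselves, not their closure, are confined to \<open>U\<close>; thus
  conjugation by any bijection carries supports to their images.\<close>

definition supported_in :: "('a \<Rightarrow> 'a) \<Rightarrow> 'a set \<Rightarrow> bool" where
  "supported_in f U \<longleftrightarrow> (\<forall>x. x \<notin> U \<longrightarrow> f x = x)"

lemma supported_in_mono: "supported_in f U \<Longrightarrow> U \<subseteq> V \<Longrightarrow> supported_in f V"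
  by (auto simp: supported_in_def)

lemma supported_in_comp: "supported_in f U \<Longrightarrow> supported_in g U \<Longrightarrow> supported_in (f \<circ> g) U"
  by (auto simp: supported_in_def)

lemma supported_in_inv: "bij f \<Longrightarrow> supported_in f U \<Longrightarrow> supported_in (inv f) U"
  unfolding supported_in_def by (metis bij_inv_eq_iff)

lemma supported_in_conj:
  "bij k \<Longrightarrow> supported_in f U \<Longrightarrow> supported_in (k \<circ> f \<circ> inv k) (k ` U)"
  unfolding supported_in_def
  by (metis bij_inv_eq_iff comp_apply image_eqI)

lemma supported_in_image:
  assumes "bij f" "supported_in f U" "x \<in> U"
  shows "f x \<in> U"
  using assms unfolding supported_in_def by (metis bij_def injD)

lemma disjoint_supports_commute:
  assumes "bij f" "bij g" "supported_in f U" "supported_in g V" "U \<inter> V = {}"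
  shows "f \<circ> g = g \<circ> f"
proof
  fix x
  consider "x \<in> U" | "x \<in> V" | "x \<notin> U" "x \<notin> V" by auto
  then show "(f \<circ> g) x = (g \<circ> f) x"
    using supported_in_image[OF assms(1,3)] supported_in_image[OF assms(2,4)] assms(3-5)
    by cases (auto simp: supported_in_def disjoint_iff, metis+)
qed

lemma commutator_eq_id: "bij f \<Longrightarrow> bij g \<Longrightarrow> f \<circ> g = g \<circ> f \<Longrightarrow> commutator f g = id"
  by (simp add: commutator_def fun_eq_iff bij_inv_eq_iff bij_is_surj surj_f_inv_f)

lemma disjoint_images_mono: "p ` A \<inter> q ` A = {} \<Longrightarrow> B \<subseteq> A \<Longrightarrow> p ` B \<inter> q ` B = {}"
  by blast

lemma continuous_separate_images:
  fixes x :: "'a::topological_space" and p q :: "'a \<Rightarrow> 'b::t2_space"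
  assumes "continuous_on UNIV p" "continuous_on UNIV q" "p x \<noteq> q x"
  obtains U where "open U" "x \<in> U" "p ` U \<inter> q ` U = {}"
proof -
  obtain X Y where "open X" "open Y" "p x \<in> X" "q x \<in> Y" "X \<inter> Y = {}"
    using hausdorff[OF assms(3)] by blast
  then show ?thesis
    using assms by (intro that[of "p -` X \<inter> q -` Y"]) (auto simp: open_Int open_vimage)
qed

text \<open>Phrased with composition and \<open>inv\<close> of functions;
  \<open>simple_subgroup_Diff_iff\<close> identifies it with normality in HOL-Algebra.\<close>

definition normal_in :: "('a \<Rightarrow> 'a) set \<Rightarrow> ('a \<Rightarrow> 'a) set \<Rightarrow> bool" where
  "normal_in D N \<longleftrightarrow> N \<subseteq> D \<and> id \<in> N \<and> (\<forall>f\<in>N. \<forall>g\<in>N. f \<circ> g \<in> N) \<and> (\<forall>f\<in>N. inv f \<in> N) \<and>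
     (\<forall>d\<in>D. \<forall>f\<in>N. d \<circ> f \<circ> inv d \<in> N)"

text \<open>Since inverses belong to \<open>G\<close>, continuity of the members makes each of them
  a homeomorphism.\<close>

locale homeo_group =
  fixes G :: "('m::t2_space \<Rightarrow> 'm) set"
  assumes id_mem: "id \<in> G"
    and comp_mem: "f \<in> G \<Longrightarrow> g \<in> G \<Longrightarrow> f \<circ> g \<in> G"
    and inv_mem: "f \<in> G \<Longrightarrow> inv f \<in> G"
    and bij_mem: "f \<in> G \<Longrightarrow> bij f"
    and continuous_mem: "f \<in> G \<Longrightarrow> continuous_on UNIV f"
begin

lemma cancel [simp]:
  assumes "f \<in> G"
  shows "inv f (f x) = x" "f (inv f x) = x" "inv (inv f) = f"
  using bij_mem[OF assms] by (simp_all add: bij_is_inj bij_is_surj surj_f_inv_f inv_inv_eq)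

lemma inv_comp [simp]: "f \<in> G \<Longrightarrow> g \<in> G \<Longrightarrow> inv (f \<circ> g) = inv g \<circ> inv f"
  by (simp add: bij_mem o_inv_distrib)

lemma commutator_mem: "f \<in> G \<Longrightarrow> g \<in> G \<Longrightarrow> commutator f g \<in> G"
  by (simp add: commutator_def comp_mem inv_mem)

lemma inv_commutator: "f \<in> G \<Longrightarrow> g \<in> G \<Longrightarrow> inv (commutator f g) = commutator g f"
  by (simp add: commutator_def comp_mem inv_mem comp_assoc)

lemma commutator_conj:
  assumes "f \<in> G" "g \<in> G" "h \<in> G"
  shows "h \<circ> commutator f g \<circ> inv h = commutator (h \<circ> f \<circ> inv h) (h \<circ> g \<circ> inv h)"
  using assms by (simp add: commutator_def comp_mem inv_mem fun_eq_iff)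

text \<open>Together with \<open>commutator_comp_right\<close> this expands a commutator of products
  into conjugates of commutators of the factors, as \<open>D_eqI\<close> requires.\<close>

lemma commutator_comp_left:
  assumes "f \<in> G" "g \<in> G" "h \<in> G"
  shows "commutator (f \<circ> g) h = (f \<circ> commutator g h \<circ> inv f) \<circ> commutator f h"
  using assms by (simp add: commutator_def comp_mem inv_mem fun_eq_iff)

lemma commutator_comp_right:
  assumes "f \<in> G" "g \<in> G" "h \<in> G"
  shows "commutator f (g \<circ> h) = commutator f g \<circ> (g \<circ> commutator f h \<circ> inv g)"
  using assms by (simp add: commutator_def comp_mem inv_mem fun_eq_iff)

lemma displaced_neighbourhood:
  assumes "g \<in> G" "g x \<noteq> x"
  obtains V where "open V" "x \<in> V" "g ` V \<inter> V = {}"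
proof -
  have "g x \<noteq> id x" using assms(2) by simp
  from continuous_separate_images[OF continuous_mem[OF assms(1)] continuous_mem[OF id_mem] this]
  obtain V where "open V" "x \<in> V" "g ` V \<inter> id ` V = {}" .
  then show ?thesis using that[of V] by simp
qed

lemma commutator_eqI:
  assumes "p \<in> G" "q \<in> G" "p \<circ> q = c \<circ> q \<circ> p"
  shows "commutator p q = c"
proof -
  have "p (q z) = c (q (p z))" for z using fun_cong[OF assms(3), of z] by simp
  from this[of "inv p (inv q z)" for z] show ?thesis
    using assms(1,2) by (simp add: commutator_def fun_eq_iff)
qed

end

text \<open>The topological core of the theorem: isotopies are forgotten and only supports of
  factors remain. The commutator group \<open>D\<close> is characterized by containing the
  commutators and by minimality. In \<open>D_minimal\<close> closure of \<open>K\<close> under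
  composition suffices, since the inverse of a commutator is a commutator.\<close>

locale factorizable_homeo_group = homeo_group G for G :: "('m::t2_space \<Rightarrow> 'm) set" +
  fixes D :: "('m \<Rightarrow> 'm) set"
  assumes moves: "\<exists>g\<in>G. g x \<noteq> x"
    and factor: "(\<And>U. U \<in> \<U> \<Longrightarrow> open U) \<Longrightarrow> \<Union>\<U> = UNIV \<Longrightarrow> g \<in> G \<Longrightarrow>
      \<exists>gs. g = foldr (\<circ>) gs id \<and> (\<forall>h\<in>set gs. h \<in> G \<and> (\<exists>U\<in>\<U>. supported_in h U))"
    and D_homeo_group: "homeo_group D"
    and D_subset: "D \<subseteq> G"
    and commutator_in_D: "f \<in> G \<Longrightarrow> g \<in> G \<Longrightarrow> commutator f g \<in> D"
    and D_minimal: "\<And>K. id \<in> K \<Longrightarrow> (\<And>f g. f \<in> K \<Longrightarrow> g \<in> K \<Longrightarrow> f \<circ> g \<in> K) \<Longrightarrow>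
      (\<And>f g. f \<in> G \<Longrightarrow> g \<in> G \<Longrightarrow> commutator f g \<in> K) \<Longrightarrow> D \<subseteq> K"
begin

sublocale D: homeo_group D by (rule D_homeo_group)

text \<open>Factors supported in \<open>-{y}\<close> fix \<open>y\<close>. If those supported in
  \<open>V\<close> fixed it as well, so would their product \<open>g\<close>.\<close>

lemma local_mover:
  assumes "open V" "y \<in> V"
  obtains f where "f \<in> G" "supported_in f V" "f y \<noteq> y"
proof -
  obtain g where g: "g \<in> G" "g y \<noteq> y" using moves by blast
  have "open U" if "U \<in> {V, -{y}}" for U using that assms(1) by auto
  moreover have "\<Union>{V, -{y}} = UNIV" using assms(2) by auto
  ultimately obtain gs where gs: "g = foldr (\<circ>) gs id"
    "\<forall>h\<in>set gs. h \<in> G \<and> (\<exists>U\<in>{V, -{y}}. supported_in h U)"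
    using factor[of "{V, -{y}}" g] g(1) by metis
  have "\<exists>h\<in>set gs. h y \<noteq> y"
  proof (rule ccontr)
    assume "\<not> ?thesis"
    then have "foldr (\<circ>) gs id y = y" by (induction gs) auto
    then show False using g gs by simp
  qed
  then obtain h where "h \<in> set gs" "h y \<noteq> y" by blast
  then show ?thesis using that[of h] gs(2) by (auto simp: supported_in_def)
qed

text \<open>If \<open>k\<close> displaces \<open>V\<close> and \<open>f\<close> is supported in
  \<open>V\<close>, then \<open>k \<circ> inv f \<circ> inv k\<close> fixes \<open>y\<close>, so
  \<open>commutator f k\<close> moves \<open>y\<close> just as \<open>f\<close> does.\<close>

lemma D_moves: obtains d where "d \<in> D" "d y \<noteq> y"
proof -
  obtain k where k: "k \<in> G" "k y \<noteq> y" using moves by blast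
  obtain V where V: "open V" "y \<in> V" "k ` V \<inter> V = {}"
    by (rule displaced_neighbourhood[OF k])
  obtain f where f: "f \<in> G" "supported_in f V" "f y \<noteq> y"
    using local_mover[OF V(1,2)] by blast
  have "supported_in (k \<circ> inv f \<circ> inv k) (k ` V)"
    using f k by (intro supported_in_conj supported_in_inv bij_mem)
  then have "(k \<circ> inv f \<circ> inv k) y = y" using V by (auto simp: supported_in_def)
  then have "commutator f k y \<noteq> y" using f by (simp add: commutator_def)
  then show ?thesis using that commutator_in_D f k by blast
qed

lemma dense_orbit_of_simple:
  assumes simple: "\<And>N. normal_in D N \<Longrightarrow> N = D \<or> N = {id}"
  shows "closure ((\<lambda>d. d x) ` D) = UNIV"
proof (rule ccontr)
  define L where "L = closure ((\<lambda>d. d x) ` D)"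
  assume "closure ((\<lambda>d. d x) ` D) \<noteq> UNIV"
  then obtain y where y: "y \<notin> L" unfolding L_def by blast
  have "id x \<in> (\<lambda>d. d x) ` D" using D.id_mem by (rule imageI)
  then have xL: "x \<in> L" using closure_subset unfolding L_def by (metis id_apply subsetD)
  have inv: "d z \<in> L" if "d \<in> D" "z \<in> L" for d z
  proof -
    have "d ` L \<subseteq> closure (d ` (\<lambda>d. d x) ` D)"
      unfolding L_def
      by (rule image_closure_subset[OF continuous_on_subset[OF D.continuous_mem[OF that(1)] subset_UNIV] closed_closure closure_subset])
    also have "\<dots> \<subseteq> L" unfolding L_def
    proof (intro closure_mono subsetI)
      fix w assume "w \<in> d ` (\<lambda>d. d x) ` D"
      then obtain e where "e \<in> D" "w = (d \<circ> e) x" by auto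
      then show "w \<in> (\<lambda>d. d x) ` D" using D.comp_mem that by blast
    qed
    finally show ?thesis using that by blast
  qed
  \<comment> \<open>The pointwise stabilizer of \<open>L\<close>; it is normal because
    \<open>L\<close> is invariant under \<open>D\<close>.\<close>
  define N where "N = {d\<in>D. \<forall>z\<in>L. d z = z}"
  have "normal_in D N" unfolding normal_in_def
  proof (intro conjI ballI)
    fix d f assume "d \<in> D" "f \<in> N"
    then show "d \<circ> f \<circ> inv d \<in> N"
      by (auto simp: N_def D.comp_mem D.inv_mem inv)
  next
    fix f assume "f \<in> N"
    moreover from this have "inv f z = z" if "z \<in> L" for z
      using that D.cancel(1)[of f z] by (simp add: N_def)
    ultimately show "inv f \<in> N" by (simp add: N_def D.inv_mem)
  qed (auto simp: N_def D.id_mem D.comp_mem)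
  moreover have "N \<noteq> D"
  proof -
    obtain d where "d \<in> D" "d x \<noteq> x" by (rule D_moves)
    then show ?thesis using xL by (auto simp: N_def)
  qed
  moreover have "N \<noteq> {id}"
  proof -
    have L: "open (- L)" unfolding L_def by (rule open_Compl[OF closed_closure])
    have yL: "y \<in> - L" using y by simp
    obtain f where f: "f \<in> G" "supported_in f (- L)" "f y \<noteq> y"
      by (rule local_mover[OF L yL])
    obtain V where V: "open V" "y \<in> V" "f ` V \<inter> V = {}"
      by (rule displaced_neighbourhood[OF f(1,3)])
    \<comment> \<open>Confining \<open>g\<close> to \<open>V\<close>, which \<open>f\<close>
      displaces, makes \<open>f \<circ> g \<circ> inv f\<close> trivial on \<open>V\<close>. So at
      \<open>y\<close> the commutator acts as \<open>inv g\<close>, which moves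
      \<open>y\<close>.\<close>
    obtain g where g: "g \<in> G" "supported_in g (V \<inter> - L)" "g y \<noteq> y"
      by (rule local_mover[OF open_Int[OF V(1) L] IntI[OF V(2) yL]])
    have gV: "supported_in (inv g) V"
      using g by (intro supported_in_inv bij_mem supported_in_mono[OF g(2)]) auto
    have "inv g y \<in> V" using supported_in_image gV V(2) g(1) by (metis bij_mem inv_mem)
    moreover have "supported_in (f \<circ> g \<circ> inv f) (f ` V)"
      using f(1) by (intro supported_in_conj bij_mem supported_in_mono[OF g(2)]) auto
    ultimately have "commutator f g y = inv g y"
      using V(3) by (auto simp: commutator_def supported_in_def)
    moreover have "inv g y \<noteq> y" using g by (metis cancel(2))
    moreover have "commutator f g z = z" if "z \<in> L" for z
    proof -
      have "supported_in (inv f) (- L)" "supported_in (inv g) (- L)" "supported_in g (- L)"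
        using f(1,2) g(1) supported_in_mono[OF g(2)] by (auto intro!: supported_in_inv bij_mem)
      then show ?thesis using f(2) that by (simp add: supported_in_def commutator_def)
    qed
    ultimately have "commutator f g \<in> N" "commutator f g y \<noteq> id y"
      using commutator_in_D f(1) g(1) by (auto simp: N_def)
    then show ?thesis by (metis singletonD)
  qed
  ultimately show False using simple by blast
qed

text \<open>The displaced copies added by \<open>k\<close> and \<open>l\<close> turn \<open>f\<close> and \<open>g\<close> into elements of \<open>D\<close>, and
  they do not contribute to the double commutator.\<close>

lemma commutator_in_normal:
  assumes N: "normal_in D N" and n: "n \<in> N" and fg: "f \<in> G" "g \<in> G" and kl: "k \<in> G" "l \<in> G"
    and supp: "supported_in f U" "supported_in g U"
    and disj: "U \<inter> (k ` U \<union> n ` U \<union> n ` k ` U) = {}"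
      "l ` U \<inter> (U \<union> k ` U \<union> n ` U \<union> n ` k ` U) = {}"
  shows "commutator f g \<in> N"
proof -
  have mem: "n \<in> D" "n \<in> G" using n N D_subset by (auto simp: normal_in_def)
  note [simp] = comp_mem inv_mem fg kl mem
  define f1 where "f1 = k \<circ> inv f \<circ> inv k"
  define g1 where "g1 = l \<circ> inv g \<circ> inv l"
  define f2 where "f2 = commutator f k"
  define g2 where "g2 = commutator g l"
  \<comment> \<open>The remainder of \<open>commutator f2 n\<close> after splitting off
    \<open>f\<close>. It is supported on the translates of \<open>U\<close> by \<open>k\<close>,
    \<open>n\<close> and \<open>n \<circ> k\<close>, hence off \<open>U\<close> and off its
    translate by \<open>l\<close>.\<close>
  define w where "w = f1 \<circ> (n \<circ> inv f2 \<circ> inv n)"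
  have f2: "f2 = f \<circ> f1" "f2 \<in> D" and g2: "g2 = g \<circ> g1" "g2 \<in> D"
    unfolding f2_def g2_def using commutator_in_D fg kl
    by (simp_all add: f1_def g1_def commutator_def comp_assoc)
  have mem1 [simp]: "f1 \<in> G" "g1 \<in> G" "f2 \<in> G" "g2 \<in> G" "w \<in> G"
    using f2 g2 D_subset by (auto simp: f1_def g1_def w_def)
  have f1: "supported_in f1 (k ` U)" and g1: "supported_in g1 (l ` U)"
    unfolding f1_def g1_def using supp by (auto intro!: supported_in_conj supported_in_inv bij_mem)
  have "supported_in f2 (U \<union> k ` U)" unfolding f2(1)
    by (intro supported_in_comp supported_in_mono[OF supp(1)] supported_in_mono[OF f1]) auto
  then have n2: "supported_in (n \<circ> inv f2 \<circ> inv n) (n ` (U \<union> k ` U))"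
    by (auto intro!: supported_in_conj supported_in_inv bij_mem)
  then have w: "supported_in w (k ` U \<union> n ` U \<union> n ` k ` U)" unfolding w_def
    using f1 n2 by (intro supported_in_comp[OF supported_in_mono[OF f1] supported_in_mono[OF n2]]) auto
  have "commutator f2 n \<in> N"
    using N n f2(2) unfolding normal_in_def commutator_def by (metis D.inv_mem comp_assoc)
  moreover have "commutator f2 n = f \<circ> w"
    by (simp add: w_def f2(1) commutator_def comp_assoc)
  ultimately have fw: "f \<circ> w \<in> N" by simp
  have "commutator (f \<circ> w) g2 = (f \<circ> w) \<circ> (g2 \<circ> inv (f \<circ> w) \<circ> inv g2)"
    by (simp add: commutator_def comp_assoc)
  then have "commutator (f \<circ> w) g2 \<in> N"
    using N fw g2(2) unfolding normal_in_def by metis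
  moreover have "commutator (f \<circ> w) g2 = commutator f g"
  proof (rule commutator_eqI)
    \<comment> \<open>Among \<open>f\<close>, \<open>w\<close>, \<open>g\<close> and
      \<open>g1\<close> only the supports of \<open>f\<close> and \<open>g\<close> overlap, so
      everything but \<open>commutator f g\<close> cancels.\<close>
    have 1: "w \<circ> g = g \<circ> w"
      by (rule disjoint_supports_commute[OF _ _ w supp(2)]) (use disj in \<open>auto simp: bij_mem\<close>)
    have 2: "w \<circ> g1 = g1 \<circ> w"
      by (rule disjoint_supports_commute[OF _ _ w g1]) (use disj in \<open>auto simp: bij_mem\<close>)
    have 3: "f \<circ> g1 = g1 \<circ> f"
      by (rule disjoint_supports_commute[OF _ _ supp(1) g1]) (use disj in \<open>auto simp: bij_mem\<close>)
    have "(f \<circ> w) \<circ> g2 = f \<circ> (w \<circ> g) \<circ> g1" by (simp add: g2 comp_assoc)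
    also have "\<dots> = f \<circ> g \<circ> (w \<circ> g1)" by (simp add: 1 comp_assoc)
    also have "\<dots> = f \<circ> g \<circ> g1 \<circ> w" by (simp add: 2 comp_assoc)
    also have "f \<circ> g = commutator f g \<circ> g \<circ> f"
      by (simp add: commutator_def fun_eq_iff)
    also have "commutator f g \<circ> g \<circ> f \<circ> g1 \<circ> w = commutator f g \<circ> g \<circ> (f \<circ> g1) \<circ> w"
      by (simp add: comp_assoc)
    also have "\<dots> = commutator f g \<circ> g2 \<circ> (f \<circ> w)"
      by (simp add: 3 g2(1) comp_assoc)
    finally show "(f \<circ> w) \<circ> g2 = commutator f g \<circ> g2 \<circ> (f \<circ> w)" .
  qed auto
  ultimately show ?thesis by simp
qed

lemma D_normal: "h \<in> G \<Longrightarrow> d \<in> D \<Longrightarrow> h \<circ> d \<circ> inv h \<in> D"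
proof -
  assume h: "h \<in> G" and d: "d \<in> D"
  have "h \<circ> d \<circ> inv h = commutator h d \<circ> d"
    using d by (simp add: commutator_def fun_eq_iff)
  then show ?thesis using h d D_subset by (auto intro: D.comp_mem commutator_in_D)
qed

text \<open>This supplies the disjointness hypotheses of \<open>commutator_in_normal\<close>. An
  infinite orbit leaves room to choose \<open>k x\<close> and \<open>l x\<close> off finitely many
  points, and continuity spreads each inequality at \<open>x\<close> to a neighbourhood.\<close>

lemma displacing_neighbourhood:
  assumes orbit: "infinite ((\<lambda>g. g x) ` G)" and n: "n \<in> G" "n x \<noteq> x"
  obtains U k l where "open U" "x \<in> U" "k \<in> G" "l \<in> G"
    "U \<inter> (k ` U \<union> n ` U \<union> n ` k ` U) = {}" "l ` U \<inter> (U \<union> k ` U \<union> n ` U \<union> n ` k ` U) = {}"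
proof -
  have avoid: "\<exists>g\<in>G. g x \<notin> S" if "finite S" for S
  proof -
    have "\<not> (\<lambda>g. g x) ` G \<subseteq> S" using that orbit finite_subset by blast
    then show ?thesis by blast
  qed
  \<comment> \<open>Avoiding \<open>inv n x\<close> guarantees
    \<open>n (k x) \<noteq> x\<close>.\<close>
  obtain k where k: "k \<in> G" "k x \<notin> {x, inv n x}" using avoid[of "{x, inv n x}"] by auto
  obtain l where l: "l \<in> G" "l x \<notin> {x, k x, n x, n (k x)}"
    using avoid[of "{x, k x, n x, n (k x)}"] by auto
  have nk: "n (k x) \<noteq> x" using k(2) cancel(1)[OF n(1), of "k x"] by force
  have sep: "\<exists>U. open U \<and> x \<in> U \<and> p ` U \<inter> q ` U = {}" if "p \<in> G" "q \<in> G" "p x \<noteq> q x" for p q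
    by (rule continuous_separate_images[OF continuous_mem[OF that(1)] continuous_mem[OF that(2)] that(3)]) blast
  obtain U1 where U1: "open U1" "x \<in> U1" "id ` U1 \<inter> k ` U1 = {}"
    using sep[of id k] k id_mem by auto
  obtain U2 where U2: "open U2" "x \<in> U2" "id ` U2 \<inter> n ` U2 = {}"
    using sep[of id n] n id_mem by auto
  obtain U3 where U3: "open U3" "x \<in> U3" "id ` U3 \<inter> (n \<circ> k) ` U3 = {}"
    using sep[of id "n \<circ> k"] n k id_mem nk comp_mem by auto
  obtain U4 where U4: "open U4" "x \<in> U4" "l ` U4 \<inter> id ` U4 = {}"
    using sep[of l id] l id_mem by auto
  obtain U5 where U5: "open U5" "x \<in> U5" "l ` U5 \<inter> k ` U5 = {}"
    using sep[of l k] l k by auto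
  obtain U6 where U6: "open U6" "x \<in> U6" "l ` U6 \<inter> n ` U6 = {}"
    using sep[of l n] l n by auto
  obtain U7 where U7: "open U7" "x \<in> U7" "l ` U7 \<inter> (n \<circ> k) ` U7 = {}"
    using sep[of l "n \<circ> k"] l n k comp_mem by auto
  define U where "U = U1 \<inter> U2 \<inter> U3 \<inter> U4 \<inter> U5 \<inter> U6 \<inter> U7"
  show ?thesis
  proof (rule that[of U k l])
    show "open U" unfolding U_def using U1 U2 U3 U4 U5 U6 U7 by (intro open_Int)
    show "x \<in> U" unfolding U_def using U1 U2 U3 U4 U5 U6 U7 by (intro IntI)
    have sub: "U \<subseteq> U1" "U \<subseteq> U2" "U \<subseteq> U3" "U \<subseteq> U4" "U \<subseteq> U5" "U \<subseteq> U6" "U \<subseteq> U7"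
      unfolding U_def by blast+
    have "U \<inter> k ` U = {}" using disjoint_images_mono[OF U1(3) sub(1)] by (simp add: image_comp)
    moreover have "U \<inter> n ` U = {}" using disjoint_images_mono[OF U2(3) sub(2)] by (simp add: image_comp)
    moreover have "U \<inter> n ` k ` U = {}" using disjoint_images_mono[OF U3(3) sub(3)] by (simp add: image_comp)
    ultimately show "U \<inter> (k ` U \<union> n ` U \<union> n ` k ` U) = {}" by blast
    have "l ` U \<inter> U = {}" using disjoint_images_mono[OF U4(3) sub(4)] by (simp add: image_comp)
    moreover have "l ` U \<inter> k ` U = {}" using disjoint_images_mono[OF U5(3) sub(5)] by (simp add: image_comp)
    moreover have "l ` U \<inter> n ` U = {}" using disjoint_images_mono[OF U6(3) sub(6)] by (simp add: image_comp)
    moreover have "l ` U \<inter> n ` k ` U = {}" using disjoint_images_mono[OF U7(3) sub(7)] by (simp add: image_comp)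
    ultimately show "l ` U \<inter> (U \<union> k ` U \<union> n ` U \<union> n ` k ` U) = {}" by blast
  qed (use k l in auto)
qed

text \<open>Both entries of a commutator factor over \<open>\<W>\<close>, and the product formulas
  reduce it to commutators of factors. The conjugating factors lie in \<open>G\<close>, which is why
  \<open>Q\<close> has to be invariant under all of \<open>G\<close>.\<close>

lemma D_eqI:
  assumes Q: "id \<in> Q" "\<And>f g. f \<in> Q \<Longrightarrow> g \<in> Q \<Longrightarrow> f \<circ> g \<in> Q"
    "\<And>f c. f \<in> Q \<Longrightarrow> c \<in> G \<Longrightarrow> c \<circ> f \<circ> inv c \<in> Q"
    and \<W>: "\<And>W. W \<in> \<W> \<Longrightarrow> open W" "\<Union>\<W> = UNIV"
    and gen: "\<And>a b W W'. a \<in> G \<Longrightarrow> b \<in> G \<Longrightarrow> W \<in> \<W> \<Longrightarrow> W' \<in> \<W> \<Longrightarrow> supported_in a W \<Longrightarrow>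
      supported_in b W' \<Longrightarrow> commutator a b \<in> Q"
  shows "D \<subseteq> Q"
proof (rule D_minimal[OF Q(1,2)])
  fix f g assume fg: "f \<in> G" "g \<in> G"
  have id: "commutator id h = id" "commutator h id = id" if "h \<in> G" for h
    using that by (simp_all add: commutator_def fun_eq_iff)
  have foldr_mem: "foldr (\<circ>) gs id \<in> G" if "set gs \<subseteq> G" for gs
    using that by (induction gs) (auto simp: id_mem comp_mem)
  \<comment> \<open>The second entry is expanded first, against a single factor \<open>a\<close>;
    \<open>left\<close> then expands the first entry.\<close>
  have right: "commutator a (foldr (\<circ>) hs id) \<in> Q"
    if a: "a \<in> G" "W \<in> \<W>" "supported_in a W"
      and "\<forall>h\<in>set hs. h \<in> G \<and> (\<exists>U\<in>\<W>. supported_in h U)" for a W hs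
    using that(4)
  proof (induction hs)
    case (Cons h hs)
    have mem: "h \<in> G" "foldr (\<circ>) hs id \<in> G" using Cons.prems by (auto intro: foldr_mem)
    obtain U where "U \<in> \<W>" "supported_in h U" using Cons.prems by auto
    then have "commutator a h \<in> Q" using gen a mem(1) by blast
    moreover have "commutator a (foldr (\<circ>) hs id) \<in> Q"
      by (rule Cons.IH) (use Cons.prems in simp)
    then have "h \<circ> commutator a (foldr (\<circ>) hs id) \<circ> inv h \<in> Q"
      using mem(1) by (rule Q(3))
    ultimately have "commutator a h \<circ> (h \<circ> commutator a (foldr (\<circ>) hs id) \<circ> inv h) \<in> Q"
      by (rule Q(2))
    then have "commutator a (h \<circ> foldr (\<circ>) hs id) \<in> Q"
      by (simp only: commutator_comp_right[OF a(1) mem])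
    then show ?case by (simp only: foldr_Cons comp_apply[of "(\<circ>) h"])
  qed (simp add: id a Q(1))
  obtain hs where hs: "g = foldr (\<circ>) hs id" "\<forall>h\<in>set hs. h \<in> G \<and> (\<exists>U\<in>\<W>. supported_in h U)"
    using factor[OF \<W> fg(2)] by blast
  have left: "commutator (foldr (\<circ>) gs id) g \<in> Q"
    if "\<forall>h\<in>set gs. h \<in> G \<and> (\<exists>U\<in>\<W>. supported_in h U)" for gs
    using that
  proof (induction gs)
    case (Cons a gs)
    have mem: "a \<in> G" "foldr (\<circ>) gs id \<in> G" using Cons.prems by (auto intro: foldr_mem)
    obtain U where "U \<in> \<W>" "supported_in a U" using Cons.prems by auto
    then have "commutator a g \<in> Q" using right mem(1) hs by blast
    moreover have "commutator (foldr (\<circ>) gs id) g \<in> Q"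
      by (rule Cons.IH) (use Cons.prems in simp)
    then have "a \<circ> commutator (foldr (\<circ>) gs id) g \<circ> inv a \<in> Q"
      using mem(1) by (rule Q(3))
    ultimately have "(a \<circ> commutator (foldr (\<circ>) gs id) g \<circ> inv a) \<circ> commutator a g \<in> Q"
      by (rule Q(2)[rotated])
    then have "commutator (a \<circ> foldr (\<circ>) gs id) g \<in> Q"
      by (simp only: commutator_comp_left[OF mem fg(2)])
    then show ?case by (simp only: foldr_Cons comp_apply[of "(\<circ>) a"])
  qed (simp add: id fg Q(1))
  obtain gs where gs: "f = foldr (\<circ>) gs id" "\<forall>h\<in>set gs. h \<in> G \<and> (\<exists>U\<in>\<W>. supported_in h U)"
    using factor[OF \<W> fg(1)] by blast
  show "commutator f g \<in> Q" unfolding gs(1) by (rule left[OF gs(2)])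
qed

lemma simple_of_dense_orbits:
  assumes para: "paracompact_space (euclidean :: 'm topology)"
    and orbit: "\<And>x. infinite ((\<lambda>g. g x) ` G)"
    and dense: "\<And>x. closure ((\<lambda>d. d x) ` D) = UNIV"
    and N: "normal_in D N" "N \<noteq> {id}"
  shows "N = D"
proof -
  have ND: "N \<subseteq> D" and N_id: "id \<in> N" and N_comp: "\<And>f g. f \<in> N \<Longrightarrow> g \<in> N \<Longrightarrow> f \<circ> g \<in> N"
    and N_conj: "\<And>d f. d \<in> D \<Longrightarrow> f \<in> N \<Longrightarrow> d \<circ> f \<circ> inv d \<in> N"
    using N(1) by (auto simp: normal_in_def)
  obtain n where n: "n \<in> N" "n \<noteq> id" using N by (auto simp: normal_in_def)
  then obtain x where x: "n x \<noteq> x" by (auto simp: fun_eq_iff)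
  have nG: "n \<in> G" using n ND D_subset by blast
  obtain U k l where U: "open U" "x \<in> U" and kl: "k \<in> G" "l \<in> G"
    and disj: "U \<inter> (k ` U \<union> n ` U \<union> n ` k ` U) = {}"
      "l ` U \<inter> (U \<union> k ` U \<union> n ` U \<union> n ` k ` U) = {}"
    by (rule displacing_neighbourhood[OF orbit nG x])
  \<comment> \<open>These preimages cover the space because every orbit of \<open>D\<close>, being
    dense, meets \<open>U\<close>.\<close>
  define \<V> where "\<V> = (\<lambda>h. h -` U) ` D"
  have \<V>_open: "open V" if "V \<in> \<V>" for V
    using that U(1) D.continuous_mem by (auto simp: \<V>_def intro: open_vimage)
  have "y \<in> \<Union>\<V>" for y
  proof -
    have "U \<inter> closure ((\<lambda>d. d y) ` D) \<noteq> {}" using dense[of y] U(2) by auto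
    then have "U \<inter> (\<lambda>d. d y) ` D \<noteq> {}" using open_Int_closure_eq_empty[OF U(1)] by blast
    then show ?thesis by (auto simp: \<V>_def)
  qed
  then have \<V>_cover: "\<Union>\<V> = UNIV" by blast
  \<comment> \<open>Conjugating by \<open>h\<close> in \<open>D\<close> moves the supports into
    \<open>U\<close>, where \<open>commutator_in_normal\<close> applies; conjugating back stays in
    \<open>N\<close>.\<close>
  have in_N: "commutator f g \<in> N"
    if V: "V \<in> \<V>" and fg: "f \<in> G" "g \<in> G" and supp: "supported_in f V" "supported_in g V" for V f g
  proof -
    obtain h where h: "h \<in> D" "V = h -` U" using V unfolding \<V>_def by blast
    have hG: "h \<in> G" using h D_subset by blast
    have hV: "h ` V \<subseteq> U" using h by auto
    have "commutator (h \<circ> f \<circ> inv h) (h \<circ> g \<circ> inv h) \<in> N"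
      using fg hG supp
      by (intro commutator_in_normal[OF N(1) n(1) _ _ kl _ _ disj] comp_mem inv_mem
          supported_in_mono[OF _ hV] supported_in_conj bij_mem)
    then have "h \<circ> commutator f g \<circ> inv h \<in> N" using fg hG by (simp add: commutator_conj)
    from N_conj[OF D.inv_mem[OF h(1)] this] show ?thesis
      using hG by (simp add: fun_eq_iff comp_def)
  qed
  \<comment> \<open>As \<open>k\<close> displaces \<open>U\<close>, its conjugate
    \<open>inv h \<circ> k \<circ> h\<close> displaces the preimage of \<open>U\<close> under
    \<open>h\<close>.\<close>
  have displaced: "\<exists>k'\<in>G. k' ` V \<inter> V = {}" if V: "V \<in> \<V>" for V
  proof -
    obtain h where h: "h \<in> D" "V = h -` U" using V unfolding \<V>_def by blast
    have hG: "h \<in> G" using h D_subset by blast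
    have "(inv h \<circ> k \<circ> h) ` V \<inter> V = {}" using h(2) hG disj by (auto simp: disjoint_iff)
    moreover have "inv h \<circ> k \<circ> h \<in> G" using hG kl by (intro comp_mem inv_mem)
    ultimately show ?thesis by (rule bexI)
  qed
  \<comment> \<open>Two refinements in succession: two meeting members of \<open>\<W>\<close> lie in
    one member of \<open>\<V>1\<close>, and any member of \<open>\<W>\<close> meeting the latter
    lies with it in one member of \<open>\<V>\<close>.\<close>
  from paracompact_t2_barycentric_refinement[OF para \<V>_open \<V>_cover]
  obtain \<V>1 where \<V>1: "\<forall>W\<in>\<V>1. open W" "\<Union>\<V>1 = UNIV"
    "\<forall>y. \<exists>V\<in>\<V>. \<forall>W\<in>\<V>1. y \<in> W \<longrightarrow> W \<subseteq> V" .
  from paracompact_t2_barycentric_refinement[OF para bspec[OF \<V>1(1)] \<V>1(2)]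
  obtain \<W> where \<W>: "\<forall>W\<in>\<W>. open W" "\<Union>\<W> = UNIV"
    "\<forall>y. \<exists>V\<in>\<V>1. \<forall>W\<in>\<W>. y \<in> W \<longrightarrow> W \<subseteq> V" .
  \<comment> \<open>The part of \<open>N\<close> that stays in \<open>N\<close> under conjugation by
    \<open>G\<close>. \<open>D_eqI\<close> asks for invariance under \<open>G\<close>, whereas
    \<open>N\<close> is only known to be invariant under \<open>D\<close>.\<close>
  define Q where "Q = {q\<in>N. \<forall>c\<in>G. c \<circ> q \<circ> inv c \<in> N}"
  have "c \<circ> id \<circ> inv c = id" if "c \<in> G" for c using that by (simp add: fun_eq_iff)
  then have id_Q: "id \<in> Q" using N_id by (simp add: Q_def)
  have "D \<subseteq> Q"
  proof (rule D_eqI[OF _ _ _ bspec[OF \<W>(1)] \<W>(2)])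
    show "id \<in> Q" by (rule id_Q)
  next
    fix f g assume fg: "f \<in> Q" "g \<in> Q"
    have "c \<circ> (f \<circ> g) \<circ> inv c \<in> N" if c: "c \<in> G" for c
    proof -
      have "c \<circ> (f \<circ> g) \<circ> inv c = (c \<circ> f \<circ> inv c) \<circ> (c \<circ> g \<circ> inv c)"
        using c by (simp add: fun_eq_iff)
      then show ?thesis using N_comp fg c by (simp add: Q_def)
    qed
    then show "f \<circ> g \<in> Q" using fg N_comp by (simp add: Q_def)
  next
    fix f c assume f: "f \<in> Q" and c: "c \<in> G"
    have "e \<circ> (c \<circ> f \<circ> inv c) \<circ> inv e \<in> N" if e: "e \<in> G" for e
    proof -
      have "e \<circ> (c \<circ> f \<circ> inv c) \<circ> inv e = (e \<circ> c) \<circ> f \<circ> inv (e \<circ> c)"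
        using c e by (simp add: comp_assoc)
      then show ?thesis using f comp_mem[OF e c] unfolding Q_def by auto
    qed
    then show "c \<circ> f \<circ> inv c \<in> Q" using f c by (simp add: Q_def)
  next
    fix a b W W'
    assume ab: "a \<in> G" "b \<in> G" and WW': "W \<in> \<W>" "W' \<in> \<W>"
      and supp: "supported_in a W" "supported_in b W'"
    show "commutator a b \<in> Q"
    proof (cases "W \<inter> W' = {}")
      case True
      have "a \<circ> b = b \<circ> a"
        by (rule disjoint_supports_commute[OF bij_mem[OF ab(1)] bij_mem[OF ab(2)] supp True])
      then have "commutator a b = id" by (rule commutator_eq_id[OF bij_mem[OF ab(1)] bij_mem[OF ab(2)]])
      then show ?thesis using id_Q by simp
    next
      case False
      then obtain y where "y \<in> W" "y \<in> W'" by blast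
      then obtain V1 where V1: "V1 \<in> \<V>1" "W \<subseteq> V1" "W' \<subseteq> V1" using spec[OF \<W>(3), of y] WW' by blast
      then have supp1: "supported_in a V1" "supported_in b V1" using supp supported_in_mono by blast+
      \<comment> \<open>The common centralizer of \<open>a\<close> and \<open>b\<close>. Once every
        \<open>c\<close> in \<open>G\<close> is written as \<open>d \<circ> c'\<close> with
        \<open>d\<close> in \<open>D\<close> and \<open>c'\<close> in \<open>C\<close>, conjugating
        \<open>commutator a b\<close> by \<open>c\<close> is the same as conjugating it by
        \<open>d\<close>.\<close>
      define C where "C = {c\<in>G. c \<circ> a = a \<circ> c \<and> c \<circ> b = b \<circ> c}"
      have C_comp: "c \<circ> c' \<in> C" if "c \<in> C" "c' \<in> C" for c c'
        using that by (auto simp: C_def comp_mem) (metis comp_assoc)+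
      text \<open>Modulo \<open>D\<close> every factor of \<open>c\<close> can be conjugated off \<open>V1\<close>, so it centralizes \<open>a\<close> and \<open>b\<close>.\<close>
      have factor_C: "\<exists>d\<in>D. \<exists>c\<in>C. h = d \<circ> c" if h: "h \<in> G" "W2 \<in> \<W>" "supported_in h W2" for h W2
      proof (cases "W2 \<inter> V1 = {}")
        case True
        have "h \<in> C" unfolding C_def
          using disjoint_supports_commute[OF bij_mem bij_mem h(3) supp1(1) True]
            disjoint_supports_commute[OF bij_mem bij_mem h(3) supp1(2) True] h(1) ab by blast
        moreover have "h = id \<circ> h" by simp
        ultimately show ?thesis using D.id_mem by blast
      next
        case False
        \<comment> \<open>The point \<open>z\<close> lies in \<open>V1\<close> and in
          \<open>V2\<close>, which contains \<open>W2\<close>; hence one displaceable set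
          \<open>V\<close> contains both \<open>V1\<close> and \<open>W2\<close>.\<close>
        then obtain z where z: "z \<in> W2" "z \<in> V1" by blast
        obtain V2 where V2: "V2 \<in> \<V>1" "\<forall>W\<in>\<W>. z \<in> W \<longrightarrow> W \<subseteq> V2"
          by (rule bexE[OF spec[OF \<W>(3), of z]])
        have W2: "W2 \<subseteq> V2" using V2(2) h(2) z(1) by (elim ballE) auto
        obtain V where V: "V \<in> \<V>" "\<forall>W\<in>\<V>1. z \<in> W \<longrightarrow> W \<subseteq> V"
          by (rule bexE[OF spec[OF \<V>1(3), of z]])
        have "z \<in> V2" using W2 z(1) by blast
        then have V12: "V1 \<subseteq> V" "V2 \<subseteq> V" using V(2) V1(1) V2(1) z(2) by simp_all
        obtain k' where k': "k' \<in> G" "k' ` V \<inter> V = {}" using displaced[OF V(1)] by blast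
        define c where "c = k' \<circ> h \<circ> inv k'"
        have cG: "c \<in> G" using k' h by (simp add: c_def comp_mem inv_mem)
        have "supported_in c (k' ` W2)" unfolding c_def
          by (rule supported_in_conj[OF bij_mem[OF k'(1)] h(3)])
        moreover have "k' ` W2 \<inter> V1 = {}" using k'(2) V12 W2 by blast
        ultimately have "c \<in> C" unfolding C_def
          using disjoint_supports_commute[OF bij_mem[OF cG] bij_mem[OF ab(1)] _ supp1(1)]
            disjoint_supports_commute[OF bij_mem[OF cG] bij_mem[OF ab(2)] _ supp1(2)] cG
          by simp
        moreover have "h = commutator h k' \<circ> c"
          using k' h by (simp add: c_def commutator_def fun_eq_iff)
        ultimately show ?thesis using commutator_in_D[OF h(1) k'(1)] by blast
      qed
      have fold_C: "\<exists>d\<in>D. \<exists>c\<in>C. foldr (\<circ>) hs id = d \<circ> c"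
        if "\<forall>h\<in>set hs. h \<in> G \<and> (\<exists>U\<in>\<W>. supported_in h U)" for hs
        using that
      proof (induction hs)
        case Nil
        have "id \<in> C" by (simp add: C_def id_mem)
        moreover have "foldr (\<circ>) [] id = id \<circ> id" by simp
        ultimately show ?case using D.id_mem by blast
      next
        case (Cons h hs)
        have "\<exists>d\<in>D. \<exists>c\<in>C. foldr (\<circ>) hs id = d \<circ> c"
          by (rule Cons.IH) (use Cons.prems in simp)
        then obtain d c where dc: "d \<in> D" "c \<in> C" "foldr (\<circ>) hs id = d \<circ> c" by blast
        obtain d' c' where dc': "d' \<in> D" "c' \<in> C" "h = d' \<circ> c'"
          using factor_C Cons.prems by (metis list.set_intros(1))
        have "c' \<in> G" using dc' by (simp add: C_def)
        \<comment> \<open>Normality of \<open>D\<close> in \<open>G\<close> lets \<open>d\<close>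
          pass to the left of \<open>c'\<close>.\<close>
        then have "foldr (\<circ>) (h # hs) id = (d' \<circ> (c' \<circ> d \<circ> inv c')) \<circ> (c' \<circ> c)"
          by (simp add: dc(3) dc'(3) fun_eq_iff)
        moreover have "d' \<circ> (c' \<circ> d \<circ> inv c') \<in> D"
          using D_normal[OF \<open>c' \<in> G\<close> dc(1)] dc'(1) by (rule D.comp_mem[rotated])
        ultimately show ?case using C_comp[OF dc'(2) dc(2)] by blast
      qed
      have ab_N: "commutator a b \<in> N"
      proof -
        obtain V where V: "V \<in> \<V>" "\<forall>W\<in>\<V>1. y \<in> W \<longrightarrow> W \<subseteq> V"
          by (rule bexE[OF spec[OF \<V>1(3), of y]])
        have "y \<in> V1" using V1(2) \<open>y \<in> W\<close> by blast
        then have "V1 \<subseteq> V" using V(2) V1(1) by simp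
        then show ?thesis using supp1 by (intro in_N[OF V(1) ab]) (auto intro: supported_in_mono)
      qed
      have "c \<circ> commutator a b \<circ> inv c \<in> N" if c: "c \<in> G" for c
      proof -
        obtain hs where hs: "c = foldr (\<circ>) hs id" "\<forall>h\<in>set hs. h \<in> G \<and> (\<exists>U\<in>\<W>. supported_in h U)"
          using factor[OF bspec[OF \<W>(1)] \<W>(2) c] by blast
        obtain d c' where dc: "d \<in> D" "c' \<in> C" "c = d \<circ> c'" using fold_C[OF hs(2)] hs(1) by auto
        have c': "c' \<in> G" "d \<in> G" "c' \<circ> a = a \<circ> c'" "c' \<circ> b = b \<circ> c'"
          using dc D_subset by (auto simp: C_def)
        have cent: "c' \<circ> a \<circ> inv c' = a" "c' \<circ> b \<circ> inv c' = b"
          using c' by (auto simp: fun_eq_iff)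
        have "c \<circ> commutator a b \<circ> inv c = d \<circ> (c' \<circ> commutator a b \<circ> inv c') \<circ> inv d"
          using c' by (simp add: dc(3) comp_assoc)
        also have "c' \<circ> commutator a b \<circ> inv c' = commutator a b"
          unfolding commutator_conj[OF ab c'(1)] cent ..
        finally have "c \<circ> commutator a b \<circ> inv c = d \<circ> commutator a b \<circ> inv d" .
        then show ?thesis using N_conj[OF dc(1) ab_N] by (simp only:)
      qed
      then show ?thesis using ab_N by (simp add: Q_def)
    qed
  qed
  then show ?thesis using ND by (auto simp: Q_def)
qed

end

section \<open>Calculus of \<open>C\<^sup>r\<close> maps\<close>

lemma C_nat_on_subset: "C_nat_on S n f \<Longrightarrow> T \<subseteq> S \<Longrightarrow> C_nat_on T n f"
  by (induction n arbitrary: f) (auto intro: continuous_on_subset)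

lemma C_nat_on_imp_continuous_on: "C_nat_on S n f \<Longrightarrow> continuous_on S f"
  by (cases n) (auto intro!: continuous_at_imp_continuous_on differentiable_imp_continuous_within)

lemma C_nat_on_Suc_D: "C_nat_on S (Suc n) f \<Longrightarrow> C_nat_on S n f"
proof (induction n arbitrary: f)
  case 0
  then show ?case by (metis C_nat_on.simps(1) C_nat_on_imp_continuous_on)
next
  case (Suc n)
  have "\<forall>v. C_nat_on S (Suc n) (\<lambda>x. frechet_derivative f (at x) v)"
    using Suc.prems by (simp only: C_nat_on.simps(2)) blast
  then have "\<forall>v. C_nat_on S n (\<lambda>x. frechet_derivative f (at x) v)" using Suc.IH by blast
  then show ?case using Suc.prems by simp
qed

lemma C_nat_on_le: "C_nat_on S n f \<Longrightarrow> m \<le> n \<Longrightarrow> C_nat_on S m f"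
  by (induction n) (auto simp: le_Suc_eq dest: C_nat_on_Suc_D simp del: C_nat_on.simps)

text \<open>Openness of \<open>S\<close> makes the derivatives of \<open>f\<close> and
  \<open>g\<close> agree on \<open>S\<close>, so the induction can pass to them.\<close>

lemma C_nat_on_cong_imp:
  assumes "open S" "\<And>x. x \<in> S \<Longrightarrow> f x = g x" "C_nat_on S n f"
  shows "C_nat_on S n g"
  using assms
proof (induction n arbitrary: f g)
  case 0
  then show ?case using continuous_on_cong by fastforce
next
  case (Suc n)
  have der: "(g has_derivative frechet_derivative f (at x)) (at x)" if "x \<in> S" for x
  proof (rule has_derivative_transform_within_open[OF _ Suc.prems(1) that])
    show "(f has_derivative frechet_derivative f (at x)) (at x)"
      using Suc.prems(3) that by (simp add: frechet_derivative_works)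
  qed (use Suc.prems in auto)
  have "C_nat_on S n (\<lambda>x. frechet_derivative g (at x) v)" for v
  proof (rule Suc.IH[OF Suc.prems(1)])
    show "C_nat_on S n (\<lambda>x. frechet_derivative f (at x) v)" using Suc.prems(3) by simp
    show "frechet_derivative f (at x) v = frechet_derivative g (at x) v" if "x \<in> S" for x
      using frechet_derivative_at[OF der[OF that]] by (rule fun_cong)
  qed
  then show ?case using der by (auto simp: differentiable_def)
qed

text \<open>With \<open>C_nat_on_SucE\<close> this replaces \<open>frechet_derivative\<close> by an
  arbitrary explicit derivative, the form in which all later inductions run.\<close>

lemma C_nat_on_SucI:
  assumes "open S" "\<And>x. x \<in> S \<Longrightarrow> (f has_derivative f' x) (at x)"
    "\<And>v. C_nat_on S n (\<lambda>x. f' x v)"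
  shows "C_nat_on S (Suc n) f"
proof -
  have "C_nat_on S n (\<lambda>x. frechet_derivative f (at x) v)" for v
    by (rule C_nat_on_cong_imp[OF assms(1) _ assms(3)]) (rule fun_cong[OF frechet_derivative_at[OF assms(2)]])
  then show ?thesis using assms(2) by (auto simp: differentiable_def)
qed

lemma C_nat_on_SucE:
  assumes "C_nat_on S (Suc n) f"
  obtains f' where "\<And>x. x \<in> S \<Longrightarrow> (f has_derivative f' x) (at x)" "\<And>v. C_nat_on S n (\<lambda>x. f' x v)"
  using assms that[of "\<lambda>x. frechet_derivative f (at x)"] by (simp add: frechet_derivative_works)

text \<open>Used where the domain of a composite must be cut into pieces that each fit into a single
  intermediate chart.\<close>

lemma C_nat_on_local:
  assumes "\<And>x. x \<in> S \<Longrightarrow> \<exists>T. open T \<and> x \<in> T \<and> C_nat_on T n f"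
  shows "C_nat_on S n f"
  using assms
proof (induction n arbitrary: f)
  case 0
  have "continuous (at x) f" if "x \<in> S" for x
    using 0[OF that] continuous_on_eq_continuous_at by auto
  then show ?case by (simp add: continuous_at_imp_continuous_on)
next
  case (Suc n)
  have "f differentiable at x" if "x \<in> S" for x
    using Suc.prems[OF that] by auto
  moreover have "C_nat_on S n (\<lambda>x. frechet_derivative f (at x) v)" for v
    by (rule Suc.IH) (use Suc.prems in force)
  ultimately show ?case by simp
qed

lemma C_nat_on_const: "open S \<Longrightarrow> C_nat_on S n (\<lambda>x. c)"
  by (induction n arbitrary: c) (auto intro!: C_nat_on_SucI[where f' = "\<lambda>x v. 0"] simp del: C_nat_on.simps(2))

lemma C_nat_on_bounded_linear:
  assumes "open S" "bounded_linear f"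
  shows "C_nat_on S n f"
proof (cases n)
  case 0
  then show ?thesis using assms by (simp add: linear_continuous_on)
next
  case (Suc m)
  then show ?thesis
    using assms by (auto intro!: C_nat_on_SucI[where f' = "\<lambda>x. f"] bounded_linear_imp_has_derivative
        C_nat_on_const simp del: C_nat_on.simps)
qed

lemma C_nat_on_bounded_linear_compose:
  assumes "open S" "bounded_linear L" "C_nat_on S n f"
  shows "C_nat_on S n (\<lambda>x. L (f x))"
  using assms(3)
proof (induction n arbitrary: f)
  case 0
  then show ?case using bounded_linear.continuous_on[OF assms(2)] by simp
next
  case (Suc n)
  obtain f' where "\<And>x. x \<in> S \<Longrightarrow> (f has_derivative f' x) (at x)" "\<And>v. C_nat_on S n (\<lambda>x. f' x v)"
    using C_nat_on_SucE[OF Suc.prems] by blast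
  then show ?case
    by (intro C_nat_on_SucI[where f' = "\<lambda>x v. L (f' x v)"] assms(1)
        bounded_linear.has_derivative[OF assms(2)] Suc.IH)
qed

lemma C_nat_on_add:
  assumes "open S" "C_nat_on S n f" "C_nat_on S n g"
  shows "C_nat_on S n (\<lambda>x. f x + g x)"
  using assms(2,3)
proof (induction n arbitrary: f g)
  case 0
  then show ?case by (simp add: continuous_on_add)
next
  case (Suc n)
  obtain f' where "\<And>x. x \<in> S \<Longrightarrow> (f has_derivative f' x) (at x)" "\<And>v. C_nat_on S n (\<lambda>x. f' x v)"
    using C_nat_on_SucE[OF Suc.prems(1)] by blast
  moreover obtain g' where "\<And>x. x \<in> S \<Longrightarrow> (g has_derivative g' x) (at x)" "\<And>v. C_nat_on S n (\<lambda>x. g' x v)"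
    using C_nat_on_SucE[OF Suc.prems(2)] by blast
  ultimately show ?case
    by (intro C_nat_on_SucI[where f' = "\<lambda>x v. f' x v + g' x v"] assms(1) has_derivative_add Suc.IH)
qed

lemma C_nat_on_sum:
  assumes "open S" "finite I" "\<And>i. i \<in> I \<Longrightarrow> C_nat_on S n (f i)"
  shows "C_nat_on S n (\<lambda>x. \<Sum>i\<in>I. f i x)"
  using assms(2,3) by (induction I) (auto intro: C_nat_on_add C_nat_on_const assms(1))

lemma C_nat_on_scaleR:
  fixes f :: "'a::euclidean_space \<Rightarrow> real"
  assumes "open S" "C_nat_on S n f" "C_nat_on S n g"
  shows "C_nat_on S n (\<lambda>x. f x *\<^sub>R g x)"
  using assms(2,3)
proof (induction n arbitrary: f g)
  case 0
  then show ?case by (simp add: continuous_on_scaleR)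
next
  case (Suc n)
  obtain f' where "\<And>x. x \<in> S \<Longrightarrow> (f has_derivative f' x) (at x)" "\<And>v. C_nat_on S n (\<lambda>x. f' x v)"
    using C_nat_on_SucE[OF Suc.prems(1)] by blast
  moreover obtain g' where "\<And>x. x \<in> S \<Longrightarrow> (g has_derivative g' x) (at x)" "\<And>v. C_nat_on S n (\<lambda>x. g' x v)"
    using C_nat_on_SucE[OF Suc.prems(2)] by blast
  ultimately show ?case
    using C_nat_on_Suc_D[OF Suc.prems(1)] C_nat_on_Suc_D[OF Suc.prems(2)]
    by (intro C_nat_on_SucI[where f' = "\<lambda>x v. f x *\<^sub>R g' x v + f' x v *\<^sub>R g x"] assms(1)
        has_derivative_scaleR C_nat_on_add Suc.IH)
qed

lemma C_nat_on_Pair: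
  assumes "open S" "C_nat_on S n f" "C_nat_on S n g"
  shows "C_nat_on S n (\<lambda>x. (f x, g x))"
  using assms(2,3)
proof (induction n arbitrary: f g)
  case 0
  then show ?case by (simp add: continuous_on_Pair)
next
  case (Suc n)
  obtain f' where "\<And>x. x \<in> S \<Longrightarrow> (f has_derivative f' x) (at x)" "\<And>v. C_nat_on S n (\<lambda>x. f' x v)"
    using C_nat_on_SucE[OF Suc.prems(1)] by blast
  moreover obtain g' where "\<And>x. x \<in> S \<Longrightarrow> (g has_derivative g' x) (at x)" "\<And>v. C_nat_on S n (\<lambda>x. g' x v)"
    using C_nat_on_SucE[OF Suc.prems(2)] by blast
  ultimately show ?case
    by (intro C_nat_on_SucI[where f' = "\<lambda>x v. (f' x v, g' x v)"] assms(1) has_derivative_Pair Suc.IH)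
qed

section \<open>Smooth families of linear maps and the inverse function theorem\<close>

lemma linear_Basis_expansion:
  fixes L :: "'a::euclidean_space \<Rightarrow> 'b::real_vector"
  assumes "linear L"
  shows "L v = (\<Sum>b\<in>Basis. (v \<bullet> b) *\<^sub>R L b)"
proof -
  have "L v = L (\<Sum>b\<in>Basis. (v \<bullet> b) *\<^sub>R b)" by (simp add: euclidean_representation)
  then show ?thesis by (simp add: linear_sum[OF assms] linear_cmul[OF assms])
qed

text \<open>Smoothness of the family \<open>L\<close> is given for fixed arguments only; expanding
  \<open>w x\<close> in the basis turns a moving argument into products of scalar and vector
  functions.\<close>

lemma C_nat_on_linear_apply:
  fixes L :: "'a::euclidean_space \<Rightarrow> 'b::euclidean_space \<Rightarrow> 'c::euclidean_space"
  assumes "open S" "\<And>x. x \<in> S \<Longrightarrow> linear (L x)" "\<And>b. C_nat_on S n (\<lambda>x. L x b)" "C_nat_on S n w"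
  shows "C_nat_on S n (\<lambda>x. L x (w x))"
proof (rule C_nat_on_cong_imp[OF assms(1)])
  have "C_nat_on S n (\<lambda>x. w x \<bullet> b)" for b
    by (rule C_nat_on_bounded_linear_compose[OF assms(1) bounded_linear_inner_left assms(4)])
  then show "C_nat_on S n (\<lambda>x. \<Sum>b\<in>Basis. (w x \<bullet> b) *\<^sub>R L x b)"
    by (intro C_nat_on_sum[OF assms(1) finite_Basis] C_nat_on_scaleR[OF assms(1) _ assms(3)])
  show "(\<Sum>b\<in>Basis. (w x \<bullet> b) *\<^sub>R L x b) = L x (w x)" if "x \<in> S" for x
    using linear_Basis_expansion[OF assms(2)[OF that]] by metis
qed

text \<open>By the chain rule the derivative is the linear family \<open>f' (g x)\<close> applied to
  the moving vector \<open>g' x v\<close>, so \<open>C_nat_on_linear_apply\<close> carries the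
  induction.\<close>

lemma C_nat_on_compose:
  assumes "open S" "open T" "g ` S \<subseteq> T" "C_nat_on T n f" "C_nat_on S n g"
  shows "C_nat_on S n (\<lambda>x. f (g x))"
  using assms(4,5)
proof (induction n arbitrary: f)
  case 0
  then show ?case using assms(3) by (auto intro: continuous_on_compose2)
next
  case (Suc n)
  obtain f' where f': "\<And>x. x \<in> T \<Longrightarrow> (f has_derivative f' x) (at x)" "\<And>v. C_nat_on T n (\<lambda>x. f' x v)"
    using C_nat_on_SucE[OF Suc.prems(1)] by blast
  obtain g' where g': "\<And>x. x \<in> S \<Longrightarrow> (g has_derivative g' x) (at x)" "\<And>v. C_nat_on S n (\<lambda>x. g' x v)"
    using C_nat_on_SucE[OF Suc.prems(2)] by blast
  show ?case
  proof (rule C_nat_on_SucI[OF assms(1)])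
    show "((\<lambda>x. f (g x)) has_derivative (\<lambda>v. f' (g x) (g' x v))) (at x)" if "x \<in> S" for x
      using has_derivative_compose[OF g'(1)[OF that] f'(1)] assms(3) that by auto
    have C: "C_nat_on S n (\<lambda>x. f' (g x) v)" for v
      by (rule Suc.IH[OF f'(2) C_nat_on_Suc_D[OF Suc.prems(2)]])
    have lin: "linear (f' (g x))" if "x \<in> S" for x
      using f'(1)[of "g x"] assms(3) that has_derivative_linear by blast
    show "C_nat_on S n (\<lambda>x. f' (g x) (g' x v))" for v
      by (rule C_nat_on_linear_apply[where L = "\<lambda>x. f' (g x)", OF assms(1) lin C g'(2)])
  qed
qed

text \<open>A product rule for a factor \<open>c\<close> that is merely continuous. As
  \<open>p x = 0\<close>, the error splits into the remainder of \<open>p\<close> times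
  \<open>c y\<close> and \<open>p' (y - x)\<close> times \<open>c y - c x\<close>; both are small
  relative to \<open>y - x\<close>.\<close>

lemma has_derivative_scaleR_vanishing:
  fixes p :: "'a::euclidean_space \<Rightarrow> real" and c :: "'a \<Rightarrow> 'b::euclidean_space"
  assumes "(p has_derivative p') (at x)" "p x = 0" "continuous (at x) c"
  shows "((\<lambda>y. p y *\<^sub>R c y) has_derivative (\<lambda>h. p' h *\<^sub>R c x)) (at x)"
proof -
  interpret p': bounded_linear p' using assms(1) by (rule has_derivative_bounded_linear)
  obtain K where K: "\<And>h. norm (p' h) \<le> norm h * K" "K > 0" using p'.pos_bounded by blast
  define e where "e y = norm (p y - p x - p' (y - x)) / norm (y - x)" for y
  have e: "(e \<longlongrightarrow> 0) (at x)"
    using assms(1) by (simp add: has_derivative_iff_norm e_def[abs_def])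
  have c: "((\<lambda>y. c y - c x) \<longlongrightarrow> 0) (at x)"
    using assms(3) by (simp add: continuous_at LIM_zero_iff)
  have bound: "((\<lambda>y. e y * norm (c y) + K * norm (c y - c x)) \<longlongrightarrow> 0 * norm (c x) + K * norm (0::'b)) (at x)"
    using assms(3) by (intro tendsto_intros e c) (simp add: continuous_at)
  have "norm (p y *\<^sub>R c y - p x *\<^sub>R c x - p' (y - x) *\<^sub>R c x) / norm (y - x)
      \<le> e y * norm (c y) + K * norm (c y - c x)" if "y \<noteq> x" for y
  proof -
    have "p y *\<^sub>R c y - p x *\<^sub>R c x - p' (y - x) *\<^sub>R c x =
        (p y - p x - p' (y - x)) *\<^sub>R c y + p' (y - x) *\<^sub>R (c y - c x)"
      using assms(2) by (simp add: algebra_simps)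
    also have "norm \<dots> \<le> norm (p y - p x - p' (y - x)) * norm (c y) + norm (p' (y - x)) * norm (c y - c x)"
      using norm_triangle_ineq by (metis norm_scaleR real_norm_def)
    also have "\<dots> \<le> (e y * norm (c y) + K * norm (c y - c x)) * norm (y - x)"
      using mult_right_mono[OF K(1)[of "y - x"], of "norm (c y - c x)"] that
      by (simp add: e_def algebra_simps)
    finally show ?thesis using that by (simp add: divide_le_eq)
  qed
  then have "((\<lambda>y. norm (p y *\<^sub>R c y - p x *\<^sub>R c x - p' (y - x) *\<^sub>R c x) / norm (y - x)) \<longlongrightarrow> 0) (at x)"
    by (intro tendsto_sandwich[OF _ _ tendsto_const bound[simplified]])
      (auto simp: eventually_at_filter)
  then show ?thesis
    by (simp add: has_derivative_iff_norm bounded_linear_scaleR_const p'.bounded_linear_axioms)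
qed

text \<open>The map \<open>\<Psi>\<close>, sending \<open>(x, v)\<close> to
  \<open>(x, L x v)\<close>, is continuous and injective on an open set in a space of the same
  dimension, so by invariance of domain its inverse, which contains \<open>B\<close>, is
  continuous.\<close>

lemma continuous_on_inverse_operator:
  fixes L B :: "'a::euclidean_space \<Rightarrow> 'b::euclidean_space \<Rightarrow> 'b"
  assumes "open S" "\<And>x. x \<in> S \<Longrightarrow> linear (L x)" "\<And>v. continuous_on S (\<lambda>x. L x v)"
    and B: "\<And>x v. x \<in> S \<Longrightarrow> B x (L x v) = v" "\<And>x v. x \<in> S \<Longrightarrow> L x (B x v) = v"
  shows "continuous_on S (\<lambda>x. B x v)"
proof -
  have "continuous_on (S \<times> UNIV) (\<lambda>z. \<Sum>b\<in>Basis. (snd z \<bullet> b) *\<^sub>R L (fst z) b)"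
    by (intro continuous_intros continuous_on_compose2[OF assms(3) continuous_on_fst]) auto
  then have cont: "continuous_on (S \<times> UNIV) (\<lambda>z. L (fst z) (snd z))"
    by (rule continuous_on_eq) (auto simp: linear_Basis_expansion[OF assms(2), symmetric])
  define \<Psi> where "\<Psi> z = (fst z, L (fst z) (snd z))" for z
  have inv: "continuous_on (\<Psi> ` (S \<times> UNIV)) (\<lambda>z. (fst z, B (fst z) (snd z)))"
    by (rule continuous_on_inverse_open)
      (auto simp: \<Psi>_def assms(1) open_Times B intro!: continuous_intros cont)
  have "(x, v) \<in> \<Psi> ` (S \<times> UNIV)" if "x \<in> S" for x v
    by (rule image_eqI[of _ _ "(x, B x v)"]) (use that B(2) in \<open>auto simp: \<Psi>_def\<close>)
  then have sub: "(\<lambda>x. (x, v)) ` S \<subseteq> \<Psi> ` (S \<times> UNIV)" by blast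
  have "continuous_on S (\<lambda>x. (x, v))" by (intro continuous_intros)
  from continuous_on_compose2[OF inv this sub]
  have "continuous_on S (\<lambda>x. (fst (x, v), B (fst (x, v)) (snd (x, v))))" .
  from continuous_on_snd[OF this] show ?thesis by simp
qed

text \<open>With \<open>u = B x v\<close> one has \<open>B y v = u - B y (L y u - L x u)\<close>. The argument of \<open>B y\<close> vanishes at
  \<open>y = x\<close>, so continuity of \<open>B\<close> suffices to differentiate this at \<open>x\<close>.\<close>

lemma C_nat_on_inverse_operator:
  fixes L B :: "'a::euclidean_space \<Rightarrow> 'b::euclidean_space \<Rightarrow> 'b"
  assumes S: "open S" and L: "\<And>x. x \<in> S \<Longrightarrow> linear (L x)" and C: "\<And>v. C_nat_on S n (\<lambda>x. L x v)"
    and B: "\<And>x v. x \<in> S \<Longrightarrow> B x (L x v) = v" "\<And>x v. x \<in> S \<Longrightarrow> L x (B x v) = v"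
  shows "C_nat_on S n (\<lambda>x. B x v)"
  using C
proof (induction n arbitrary: v)
  case 0
  then have "continuous_on S (\<lambda>x. B x v)" by (intro continuous_on_inverse_operator[OF S L _ B]) simp_all
  then show ?case by simp
next
  case (Suc n)
  have lin: "linear (B x)" if "x \<in> S" for x
  proof (rule linearI)
    fix u w
    have "B x (L x (B x u + B x w)) = B x (u + w)" by (simp add: linear_add[OF L] B that)
    then show "B x (u + w) = B x u + B x w" by (simp add: B that)
  next
    fix c u
    have "B x (L x (c *\<^sub>R B x u)) = B x (c *\<^sub>R u)" by (simp add: linear_cmul[OF L] B that)
    then show "B x (c *\<^sub>R u) = c *\<^sub>R B x u" by (simp add: B that)
  qed
  have "continuous_on S (\<lambda>x. B x v)" for v
    by (rule continuous_on_inverse_operator[OF S L C_nat_on_imp_continuous_on[OF Suc.prems] B])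
  then have cont: "continuous (at x) (\<lambda>x. B x v)" if "x \<in> S" for x v
    using continuous_on_eq_continuous_at[OF S] that by blast
  define L' where "L' u x = frechet_derivative (\<lambda>x. L x u) (at x)" for u x
  have L': "((\<lambda>x. L x u) has_derivative L' u x) (at x)" if "x \<in> S" for u x
    using Suc.prems[of u] that by (simp add: L'_def frechet_derivative_works)
  have CL': "C_nat_on S n (\<lambda>x. L' u x v)" for u v
    using Suc.prems[of u] by (simp add: L'_def)
  have IH: "C_nat_on S n (\<lambda>x. B x v)" for v
    by (rule Suc.IH) (rule C_nat_on_Suc_D[OF Suc.prems])
  \<comment> \<open>Linearity in \<open>u\<close> is what permits the moving argument
    \<open>u = B x v\<close> in \<open>C_nat_on_linear_apply\<close> below.\<close>
  have linL': "linear (\<lambda>u. L' u x h)" if "x \<in> S" for x h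
  proof (rule linearI)
    fix u w
    have "((\<lambda>y. L y u + L y w) has_derivative L' (u + w) x) (at x)"
      by (rule has_derivative_transform_within_open[OF L'[OF that] S that])
        (simp add: linear_add[OF L])
    moreover have "((\<lambda>y. L y u + L y w) has_derivative (\<lambda>h. L' u x h + L' w x h)) (at x)"
      by (intro has_derivative_add L' that)
    ultimately show "L' (u + w) x h = L' u x h + L' w x h"
      by (metis has_derivative_unique)
  next
    fix c :: real and u
    have "((\<lambda>y. c *\<^sub>R L y u) has_derivative L' (c *\<^sub>R u) x) (at x)"
      by (rule has_derivative_transform_within_open[OF L'[OF that] S that])
        (simp add: linear_cmul[OF L])
    moreover have "((\<lambda>y. c *\<^sub>R L y u) has_derivative (\<lambda>h. c *\<^sub>R L' u x h)) (at x)"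
      by (intro has_derivative_scaleR_right L' that)
    ultimately show "L' (c *\<^sub>R u) x h = c *\<^sub>R L' u x h"
      by (metis has_derivative_unique)
  qed
  show ?case
  proof (rule C_nat_on_SucI[OF S])
    fix x assume x: "x \<in> S"
    define u where "u = B x v"
    \<comment> \<open>In coordinates each summand is a scalar vanishing at \<open>y = x\<close>
      times the merely continuous \<open>B y b\<close>. On \<open>S\<close> the whole expression
      equals \<open>B y v\<close>.\<close>
    have "((\<lambda>y. v - (\<Sum>b\<in>Basis. ((L y u - L x u) \<bullet> b) *\<^sub>R B y b) - (v - u)) has_derivative
        (\<lambda>h. 0 - (\<Sum>b\<in>Basis. (L' u x h \<bullet> b) *\<^sub>R B x b) - 0)) (at x)"
      using L'[OF x, of u]
      by (intro has_derivative_diff has_derivative_const has_derivative_sum has_derivative_scaleR_vanishing cont[OF x])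
        (auto intro!: derivative_eq_intros)
    then have der: "((\<lambda>y. B y v) has_derivative
        (\<lambda>h. 0 - (\<Sum>b\<in>Basis. (L' u x h \<bullet> b) *\<^sub>R B x b) - 0)) (at x)"
    proof (rule has_derivative_transform_within_open[OF _ S x])
      fix y assume y: "y \<in> S"
      have "(\<Sum>b\<in>Basis. ((L y u - L x u) \<bullet> b) *\<^sub>R B y b) = B y (L y u - L x u)"
        using linear_Basis_expansion[OF lin[OF y]] by metis
      also have "\<dots> = u - B y v"
        using B x y by (simp add: linear_diff[OF lin[OF y]] u_def)
      finally show "v - (\<Sum>b\<in>Basis. ((L y u - L x u) \<bullet> b) *\<^sub>R B y b) - (v - u) = B y v" by simp
    qed
    have "0 - (\<Sum>b\<in>Basis. (L' u x h \<bullet> b) *\<^sub>R B x b) - 0 = - B x (L' (B x v) x h)" for h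
      unfolding linear_Basis_expansion[OF lin[OF x], of "L' (B x v) x h"] u_def by simp
    then show "((\<lambda>y. B y v) has_derivative (\<lambda>h. - B x (L' (B x v) x h))) (at x)"
      using der by (simp only:)
  next
    fix h
    have "C_nat_on S n (\<lambda>x. L' (B x v) x h)"
      by (rule C_nat_on_linear_apply[where L = "\<lambda>x u. L' u x h", OF S linL' CL' IH])
    from C_nat_on_linear_apply[OF S lin IH this]
    have "C_nat_on S n (\<lambda>x. B x (L' (B x v) x h))" .
    then show "C_nat_on S n (\<lambda>x. - B x (L' (B x v) x h))"
      by (rule C_nat_on_bounded_linear_compose[OF S bounded_linear_minus[OF bounded_linear_ident]])
  qed
qed

text \<open>Invariance of domain gives openness and continuity of \<open>g\<close>. For positive
  order, the derivative of \<open>g\<close> at \<open>f x\<close> is the inverse \<open>B x\<close>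
  of the derivative of \<open>f\<close>, which is as smooth as that derivative by
  \<open>C_nat_on_inverse_operator\<close>.\<close>

lemma C_nat_on_inverse:
  fixes f g :: "'a::euclidean_space \<Rightarrow> 'a"
  assumes S: "open S" and f: "C_nat_on S n f" and g: "\<And>x. x \<in> S \<Longrightarrow> g (f x) = x"
    and inj: "\<And>x v f'. x \<in> S \<Longrightarrow> 0 < n \<Longrightarrow> (f has_derivative f') (at x) \<Longrightarrow> f' v = 0 \<Longrightarrow> v = 0"
  shows "open (f ` S)" "C_nat_on (f ` S) n g"
proof -
  have cf: "continuous_on S f" using f by (rule C_nat_on_imp_continuous_on)
  show op: "open (f ` S)"
    by (rule invariance_of_domain[OF cf S]) (use g in \<open>auto intro: inj_on_inverseI\<close>)
  have cg: "continuous_on (f ` S) g"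
    by (rule continuous_on_inverse_open[OF S cf _ g]) simp_all
  \<comment> \<open>The class of \<open>f\<close> stays fixed while that of \<open>g\<close> climbs:
    if \<open>g\<close> is of class C^m, so is its derivative \<open>B (g y)\<close>, and
    \<open>g\<close> gains one order.\<close>
  have "C_nat_on (f ` S) m g" if "m \<le> n" for m
    using that
  proof (induction m)
    case 0
    then show ?case using cg by simp
  next
    case (Suc m)
    obtain f' where f': "\<And>x. x \<in> S \<Longrightarrow> (f has_derivative f' x) (at x)" "\<And>v. C_nat_on S m (\<lambda>x. f' x v)"
      using C_nat_on_SucE[OF C_nat_on_le[OF f Suc.prems]] by blast
    have lin: "linear (f' x)" if "x \<in> S" for x using f'(1)[OF that] by (rule has_derivative_linear)
    have "\<exists>h. linear h \<and> h \<circ> f' x = id" if "x \<in> S" for x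
    proof (rule linear_injective_left_inverse[OF lin[OF that]])
      show "inj (f' x)"
        using inj[OF that _ f'(1)[OF that]] Suc.prems linear_injective_0[OF lin[OF that]] by auto
    qed
    then obtain B where B: "\<And>x. x \<in> S \<Longrightarrow> linear (B x)" "\<And>x. x \<in> S \<Longrightarrow> B x \<circ> f' x = id" by metis
    have B1: "B x (f' x v) = v" if "x \<in> S" for x v using B(2)[OF that] by (metis comp_apply id_apply)
    have B2: "f' x (B x v) = v" if "x \<in> S" for x v
      using linear_inverse_left[OF lin[OF that] B(1)[OF that]] B(2)[OF that] by (metis comp_apply id_apply)
    have CB: "C_nat_on S m (\<lambda>x. B x v)" for v
      by (rule C_nat_on_inverse_operator[OF S lin f'(2) B1 B2])
    show ?case
    proof (rule C_nat_on_SucI[OF op])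
      show "(g has_derivative B (g y)) (at y)" if "y \<in> f ` S" for y
      proof -
        obtain x where x: "x \<in> S" "y = f x" using \<open>y \<in> f ` S\<close> by blast
        have "bounded_linear (B x)" using B(1)[OF x(1)] by (simp add: linear_linear)
        from has_derivative_inverse_dieudonne[OF S op cf cg g x(1) f'(1)[OF x(1)] this B(2)[OF x(1)]]
        show ?thesis by (simp add: x g)
      qed
      have "C_nat_on (f ` S) m g" using Suc by simp
      then show "C_nat_on (f ` S) m (\<lambda>y. B (g y) v)" for v
        by (intro C_nat_on_compose[OF op S _ CB]) (auto simp: g)
    qed
  qed
  then show "C_nat_on (f ` S) n g" by simp
qed

section \<open>Isotopies on manifolds\<close>

lemma C_on_le: "C_on r S f \<Longrightarrow> enat n \<le> r \<Longrightarrow> C_nat_on S n f"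
  by (simp add: C_on_def)

text \<open>The topological part of \<open>smooth_manifold\<close>, singled out because
  \<open>C_map_comp\<close> rests on it and \<open>topological_atlas_prod\<close> establishes it for
  products.\<close>

definition topological_atlas :: "('m::t2_space, 'e::euclidean_space) atlas \<Rightarrow> bool" where
  "topological_atlas A \<longleftrightarrow>
     (\<Union>(U, \<phi>)\<in>A. U) = UNIV \<and>
     (\<forall>(U, \<phi>)\<in>A. open U \<and> open (\<phi> ` U) \<and> homeomorphism U (\<phi> ` U) \<phi> (inv_into U \<phi>))"

lemma smooth_manifold_imp_topological_atlas: "smooth_manifold A \<Longrightarrow> topological_atlas A"
  by (simp add: smooth_manifold_def topological_atlas_def)

lemma chart_at:
  assumes "topological_atlas A"
  obtains U \<phi> where "(U, \<phi>) \<in> A" "x \<in> U"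
proof -
  have "x \<in> (\<Union>(U, \<phi>)\<in>A. U)" using assms by (simp add: topological_atlas_def)
  then show ?thesis using that by blast
qed

lemma
  assumes "topological_atlas A" "(U, \<phi>) \<in> A"
  shows chart_open: "open U" "open (\<phi> ` U)"
    and chart_homeomorphism: "homeomorphism U (\<phi> ` U) \<phi> (inv_into U \<phi>)"
  using assms by (auto simp: topological_atlas_def)

lemma chart_inv:
  assumes "topological_atlas A" "(U, \<phi>) \<in> A" "x \<in> U"
  shows "inv_into U \<phi> (\<phi> x) = x"
  using homeomorphism_apply1[OF chart_homeomorphism[OF assms(1,2)] assms(3)] .

lemma chart_inj_on:
  assumes "topological_atlas A" "(U, \<phi>) \<in> A"
  shows "inj_on \<phi> U"
  using chart_inv[OF assms] by (rule inj_on_inverseI)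

lemma chart_open_image:
  assumes "topological_atlas A" "(U, \<phi>) \<in> A" "open W" "W \<subseteq> U"
  shows "open (\<phi> ` W)"
proof -
  have "\<phi> ` W = \<phi> ` U \<inter> inv_into U \<phi> -` W"
    using chart_inv[OF assms(1,2)] assms(4) by auto
  also have "open \<dots>"
    using homeomorphism_cont2[OF chart_homeomorphism[OF assms(1,2)]] assms(3)
      chart_open(2)[OF assms(1,2)] continuous_open_preimage by blast
  finally show ?thesis .
qed

lemma C_map_continuous: "C_map r A B f \<Longrightarrow> continuous_on UNIV f"
  by (simp add: C_map_def)

lemma C_map_chart:
  assumes "C_map r A B f" "(U, \<phi>) \<in> A" "(V, \<psi>) \<in> B"
  shows "C_on r (\<phi> ` (U \<inter> f -` V)) (\<psi> \<circ> f \<circ> inv_into U \<phi>)"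
  using assms by (auto simp: C_map_def)

lemma C_mapI:
  assumes "continuous_on UNIV f"
    "\<And>U \<phi> V \<psi> n. (U, \<phi>) \<in> A \<Longrightarrow> (V, \<psi>) \<in> B \<Longrightarrow> enat n \<le> r \<Longrightarrow>
      C_nat_on (\<phi> ` (U \<inter> f -` V)) n (\<psi> \<circ> f \<circ> inv_into U \<phi>)"
  shows "C_map r A B f"
  using assms by (auto simp: C_map_def C_on_def)

text \<open>\<open>C_map\<close> speaks about all pairs of charts, so near each point any chart of
  \<open>B\<close> around \<open>g x\<close> splits the composite into two chart
  representatives.\<close>

lemma C_map_comp:
  assumes A: "topological_atlas A" and B: "topological_atlas B" and C: "topological_atlas C"
    and f: "C_map r B C f" and g: "C_map r A B g"
  shows "C_map r A C (f \<circ> g)"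
proof (rule C_mapI)
  have cf: "continuous_on UNIV f" and cg: "continuous_on UNIV g"
    using f g by (auto dest: C_map_continuous)
  then show "continuous_on UNIV (f \<circ> g)"
    by (intro continuous_on_compose) (auto intro: continuous_on_subset)
  fix U \<phi> W \<eta> n
  assume U: "(U, \<phi>) \<in> A" and W: "(W, \<eta>) \<in> C" and n: "enat n \<le> r"
  show "C_nat_on (\<phi> ` (U \<inter> (f \<circ> g) -` W)) n (\<eta> \<circ> (f \<circ> g) \<circ> inv_into U \<phi>)"
  proof (rule C_nat_on_local)
    fix p assume "p \<in> \<phi> ` (U \<inter> (f \<circ> g) -` W)"
    then obtain x where x: "x \<in> U" "f (g x) \<in> W" "p = \<phi> x" by auto
    obtain V \<psi> where V: "(V, \<psi>) \<in> B" "g x \<in> V" by (rule chart_at[OF B])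
    have "C_on r (\<phi> ` (U \<inter> g -` V)) (\<psi> \<circ> g \<circ> inv_into U \<phi>)" by (rule C_map_chart[OF g U V(1)])
    show "\<exists>T. open T \<and> p \<in> T \<and> C_nat_on T n (\<eta> \<circ> (f \<circ> g) \<circ> inv_into U \<phi>)"
    proof -
      define T where "T = \<phi> ` (U \<inter> g -` (V \<inter> f -` W))"
      define T' where "T' = \<psi> ` (V \<inter> f -` W)"
      have op: "open (V \<inter> f -` W)"
        using chart_open(1)[OF C W] chart_open(1)[OF B V(1)] cf by (intro open_Int open_vimage)
      have T: "open T" unfolding T_def
        by (rule chart_open_image[OF A U open_Int[OF chart_open(1)[OF A U] open_vimage[OF op cg]]]) blast
      have T': "open T'" unfolding T'_def
        by (rule chart_open_image[OF B V(1) op]) blast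
      have p: "p \<in> T" using x V by (auto simp: T_def)
      have "C_nat_on T n (\<lambda>z. (\<eta> \<circ> f \<circ> inv_into V \<psi>) ((\<psi> \<circ> g \<circ> inv_into U \<phi>) z))"
      proof (rule C_nat_on_compose[OF T T'])
        show "(\<psi> \<circ> g \<circ> inv_into U \<phi>) ` T \<subseteq> T'"
          using chart_inv[OF A U] by (auto simp: T_def T'_def)
        show "C_nat_on T' n (\<eta> \<circ> f \<circ> inv_into V \<psi>)"
          unfolding T'_def by (rule C_on_le[OF C_map_chart[OF f V(1) W] n])
        show "C_nat_on T n (\<psi> \<circ> g \<circ> inv_into U \<phi>)"
          by (rule C_nat_on_subset[OF C_on_le[OF C_map_chart[OF g U V(1)] n]]) (auto simp: T_def)
      qed
      then have "C_nat_on T n (\<eta> \<circ> (f \<circ> g) \<circ> inv_into U \<phi>)"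
        by (rule C_nat_on_cong_imp[OF T, rotated])
          (use chart_inv[OF A U] chart_inv[OF B V(1)] in \<open>auto simp: T_def\<close>)
      then show ?thesis using T p by blast
    qed
  qed
qed

text \<open>In charts the identity is a change of charts; this is where compatibility of the atlas
  enters.\<close>

lemma C_map_id:
  assumes "smooth_manifold A"
  shows "C_map r A A id"
proof (rule C_mapI)
  fix U \<phi> V \<psi> n assume "(U, \<phi>) \<in> A" "(V, \<psi>) \<in> A"
  then have "C_on \<infinity> (\<phi> ` (U \<inter> V)) (\<psi> \<circ> inv_into U \<phi>)"
    using assms by (auto simp: smooth_manifold_def)
  then show "C_nat_on (\<phi> ` (U \<inter> id -` V)) n (\<psi> \<circ> id \<circ> inv_into U \<phi>)"
    by (simp add: C_on_def)
qed simp

section \<open>Products of a Euclidean space with a manifold\<close>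

lemma prod_atlas_standard_iff:
  "(X, \<xi>) \<in> prod_atlas standard_atlas A \<longleftrightarrow> (\<exists>U \<phi>. (U, \<phi>) \<in> A \<and> X = UNIV \<times> U \<and> \<xi> = map_prod id \<phi>)"
  by (auto simp: prod_atlas_def standard_atlas_def)

lemma map_prod_id_image: "map_prod id \<phi> ` (UNIV \<times> U) = UNIV \<times> \<phi> ` U"
  by (auto intro: rev_image_eqI)

lemma prod_chart_inv:
  assumes "topological_atlas A" "(U, \<phi>) \<in> A" "x \<in> U"
  shows "inv_into (UNIV \<times> U) (map_prod id \<phi>) (t, \<phi> x) = (t, x)"
proof -
  have "inj_on (map_prod id \<phi>) (UNIV \<times> U)"
    using map_prod_inj_on[OF inj_on_id chart_inj_on[OF assms(1,2)]] .
  then have "inv_into (UNIV \<times> U) (map_prod id \<phi>) (map_prod id \<phi> (t, x)) = (t, x)"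
    by (rule inv_into_f_f) (simp add: assms)
  then show ?thesis by simp
qed

lemma topological_atlas_prod:
  fixes A :: "('m::t2_space, 'e::euclidean_space) atlas"
  assumes A: "topological_atlas A"
  shows "topological_atlas (prod_atlas (standard_atlas :: ('d::euclidean_space, 'd) atlas) A)"
  unfolding topological_atlas_def
proof (intro conjI)
  let ?P = "prod_atlas (standard_atlas :: ('d, 'd) atlas) A"
  have "p \<in> (\<Union>(U, \<phi>)\<in>?P. U)" for p
  proof -
    obtain U \<phi> where "(U, \<phi>) \<in> A" "snd p \<in> U" by (rule chart_at[OF A])
    then have "(UNIV \<times> U, map_prod id \<phi>) \<in> ?P" "p \<in> UNIV \<times> U"
      by (auto simp: prod_atlas_standard_iff mem_Times_iff)
    then show ?thesis by blast
  qed
  then show "(\<Union>(U, \<phi>)\<in>?P. U) = UNIV" by blast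
  have "open X \<and> open (\<xi> ` X) \<and> homeomorphism X (\<xi> ` X) \<xi> (inv_into X \<xi>)" if "(X, \<xi>) \<in> ?P" for X \<xi>
  proof -
    obtain U \<phi> where U: "(U, \<phi>) \<in> A" and X: "X = UNIV \<times> U" "\<xi> = map_prod id \<phi>"
      using \<open>(X, \<xi>) \<in> ?P\<close> unfolding prod_atlas_standard_iff by blast
    have "continuous_on (UNIV \<times> U) (map_prod (id :: 'd \<Rightarrow> 'd) \<phi>)"
      unfolding map_prod_def case_prod_beta id_apply
      by (intro continuous_on_Pair continuous_on_fst continuous_on_id
          continuous_on_compose2[OF homeomorphism_cont1[OF chart_homeomorphism[OF A U]]]
          continuous_on_snd) auto
    moreover have "continuous_on (UNIV \<times> \<phi> ` U) (\<lambda>z. (fst z :: 'd, inv_into U \<phi> (snd z)))"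
      by (intro continuous_on_Pair continuous_on_fst continuous_on_id
          continuous_on_compose2[OF homeomorphism_cont2[OF chart_homeomorphism[OF A U]]]
          continuous_on_snd) auto
    then have "continuous_on (UNIV \<times> \<phi> ` U) (inv_into (UNIV \<times> U) (map_prod (id :: 'd \<Rightarrow> 'd) \<phi>))"
      by (rule continuous_on_eq) (auto simp: prod_chart_inv[OF A U] chart_inv[OF A U])
    ultimately have "homeomorphism X (\<xi> ` X) \<xi> (inv_into X \<xi>)"
      unfolding X map_prod_id_image homeomorphism_def
      by (force simp: prod_chart_inv[OF A U])
    moreover have "open X" "open (\<xi> ` X)"
      unfolding X map_prod_id_image using chart_open[OF A U] by (auto intro: open_Times)
    ultimately show ?thesis by blast
  qed
  then show "\<forall>(U, \<phi>)\<in>?P. open U \<and> open (\<phi> ` U) \<and> homeomorphism U (\<phi> ` U) \<phi> (inv_into U \<phi>)"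
    by blast
qed

lemma C_map_fst:
  fixes A :: "('m::t2_space, 'e::euclidean_space) atlas"
  assumes A: "topological_atlas A"
  shows "C_map r (prod_atlas (standard_atlas :: ('d::euclidean_space, 'd) atlas) A) standard_atlas fst"
proof (rule C_mapI)
  fix X :: "('d \<times> 'm) set" and \<xi> V and \<psi> :: "'d \<Rightarrow> 'd" and n
  assume X: "(X, \<xi>) \<in> prod_atlas standard_atlas A" and V: "(V, \<psi>) \<in> standard_atlas"
  obtain U \<phi> where U: "(U, \<phi>) \<in> A" and X: "X = UNIV \<times> U" "\<xi> = map_prod id \<phi>"
    using X unfolding prod_atlas_standard_iff by blast
  have V: "V = UNIV" "\<psi> = id" using V by (auto simp: standard_atlas_def)
  have op: "open (\<xi> ` (X \<inter> fst -` V))"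
    using chart_open[OF A U] by (simp add: V X map_prod_id_image open_Times)
  show "C_nat_on (\<xi> ` (X \<inter> fst -` V)) n (\<psi> \<circ> fst \<circ> inv_into X \<xi>)"
    by (rule C_nat_on_cong_imp[OF op _ C_nat_on_bounded_linear[OF op bounded_linear_fst]])
      (auto simp: X V prod_chart_inv[OF A U])
qed (intro continuous_intros)

lemma C_map_Pair:
  fixes A :: "('m::t2_space, 'e::euclidean_space) atlas"
    and f :: "'n::t2_space \<Rightarrow> 'd::euclidean_space"
  assumes A: "topological_atlas A" and B: "topological_atlas B"
    and f: "C_map r B standard_atlas f" and g: "C_map r B A g"
  shows "C_map r B (prod_atlas standard_atlas A) (\<lambda>x. (f x, g x))"
proof (rule C_mapI)
  show "continuous_on UNIV (\<lambda>x. (f x, g x))"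
    using f g by (intro continuous_intros) (auto dest: C_map_continuous)
  fix U \<phi> Y and \<eta> :: "'d \<times> 'm \<Rightarrow> 'd \<times> 'e" and n
  assume U: "(U, \<phi>) \<in> B" and Y: "(Y, \<eta>) \<in> prod_atlas standard_atlas A" and n: "enat n \<le> r"
  obtain V \<psi> where V: "(V, \<psi>) \<in> A" and Y: "Y = UNIV \<times> V" "\<eta> = map_prod id \<psi>"
    using Y unfolding prod_atlas_standard_iff by blast
  define S where "S = \<phi> ` (U \<inter> g -` V)"
  have S: "S = \<phi> ` (U \<inter> (\<lambda>x. (f x, g x)) -` Y)" by (auto simp: S_def Y)
  have op: "open S" unfolding S_def
    by (rule chart_open_image[OF B U open_Int[OF chart_open(1)[OF B U]
            open_vimage[OF chart_open(1)[OF A V] C_map_continuous[OF g]]]]) blast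
  have "(UNIV, id) \<in> (standard_atlas :: ('d, 'd) atlas)" by (simp add: standard_atlas_def)
  from C_on_le[OF C_map_chart[OF f U this] n]
  have "C_nat_on S n (id \<circ> f \<circ> inv_into U \<phi>)" by (rule C_nat_on_subset) (auto simp: S_def)
  then have "C_nat_on S n (\<lambda>z. ((id \<circ> f \<circ> inv_into U \<phi>) z, (\<psi> \<circ> g \<circ> inv_into U \<phi>) z))"
    using C_on_le[OF C_map_chart[OF g U V] n] unfolding S_def[symmetric]
    by (rule C_nat_on_Pair[OF op])
  then show "C_nat_on (\<phi> ` (U \<inter> (\<lambda>x. (f x, g x)) -` Y)) n (\<eta> \<circ> (\<lambda>x. (f x, g x)) \<circ> inv_into U \<phi>)"
    unfolding S[symmetric] by (simp add: Y comp_def)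
qed

section \<open>Pointwise products and inverses of isotopies\<close>

lemma C_diffeo_comp:
  assumes "topological_atlas A" "C_diffeo r A f" "C_diffeo r A g"
  shows "C_diffeo r A (f \<circ> g)"
  using assms C_map_comp[OF assms(1,1,1)]
  by (simp add: C_diffeo_def bij_comp o_inv_distrib)

lemma C_diffeo_inv: "C_diffeo r A f \<Longrightarrow> C_diffeo r A (inv f)"
  by (simp add: C_diffeo_def bij_imp_bij_inv inv_inv_eq)

lemma C_diffeo_id: "smooth_manifold A \<Longrightarrow> C_diffeo r A id"
  by (simp add: C_diffeo_def C_map_id)

text \<open>Joint smoothness follows by composing the map of \<open>F\<close> with the track
  \<open>(t, x) \<mapsto> (t, K t x)\<close>.\<close>

lemma isotopy_comp:
  assumes A: "topological_atlas A" and F: "isotopy r A F" and K: "isotopy r A K"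
  shows "isotopy r A (\<lambda>t. F t \<circ> K t)"
proof -
  let ?P = "prod_atlas (standard_atlas :: (real, real) atlas) A"
  note P = topological_atlas_prod[OF A, where 'd = real]
  have f: "C_map r ?P A (\<lambda>(t, x). F t x)" and k: "C_map r ?P A (\<lambda>(t, x). K t x)"
    using F K by (auto simp: isotopy_def)
  have "C_map r ?P A ((\<lambda>(t, x). F t x) \<circ> (\<lambda>z. (fst z, (\<lambda>(t, x). K t x) z)))"
    by (rule C_map_comp[OF P P A f C_map_Pair[OF A P C_map_fst[OF A] k]])
  also have "(\<lambda>(t, x). F t x) \<circ> (\<lambda>z. (fst z, (\<lambda>(t, x). K t x) z)) = (\<lambda>(t, x). (F t \<circ> K t) x)"
    by auto
  finally show ?thesis
    using F K by (simp add: isotopy_def C_diffeo_comp[OF A])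
qed

text \<open>In charts, the track \<open>(t, x) \<mapsto> (t, F t x)\<close> is an injective \<open>C\<^sup>r\<close> map of an open set onto an open
  set. Its derivative is injective because each \<open>F t\<close> is a diffeomorphism.\<close>

lemma isotopy_inv_chart:
  assumes A: "topological_atlas A" and r: "1 \<le> r" and F: "isotopy r A F"
    and U: "(U, \<phi>) \<in> A" and V: "(V, \<psi>) \<in> A" and n: "enat n \<le> r"
  defines "S \<equiv> map_prod id \<phi> ` (UNIV \<times> U \<inter> (\<lambda>(t, y). inv (F t) y) -` V)"
  shows "open S"
    and "C_nat_on S n (\<psi> \<circ> (\<lambda>(t, y). inv (F t) y) \<circ> inv_into (UNIV \<times> U) (map_prod id \<phi>))"
proof -
  let ?P = "prod_atlas (standard_atlas :: (real, real) atlas) A"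
  note P = topological_atlas_prod[OF A, where 'd = real]
  define f where "f = (\<lambda>(t, x). F t x)"
  define g where "g = (\<lambda>(t, y). inv (F t) y)"
  have f: "C_map r ?P A f" using F by (simp add: isotopy_def f_def)
  have diffeo: "C_diffeo r A (F t)" for t using F by (simp add: isotopy_def)
  have bij: "bij (F t)" for t using diffeo by (simp add: C_diffeo_def)
  have Finv: "inv (F t) (F t x) = x" "F t (inv (F t) y) = y" for t x y
    using bij[of t] by (simp_all add: bij_is_inj bij_is_surj surj_f_inv_f)
  have VP: "(UNIV \<times> V, map_prod id \<psi>) \<in> ?P" using V by (auto simp: prod_atlas_standard_iff)
  define O1 where "O1 = map_prod id \<psi> ` (UNIV \<times> V \<inter> f -` U)"
  define f1 where "f1 = \<phi> \<circ> f \<circ> inv_into (UNIV \<times> V) (map_prod id \<psi>)"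
  define g1 where "g1 = \<psi> \<circ> g \<circ> inv_into (UNIV \<times> U) (map_prod id \<phi>)"
  \<comment> \<open>\<open>\<Phi>\<close> is the track of \<open>F\<close> in charts and
    \<open>\<Gamma>\<close> the track of the inverse isotopy.\<close>
  define \<Phi> where "\<Phi> z = (fst z, f1 z)" for z
  define \<Gamma> where "\<Gamma> z = (fst z, g1 z)" for z
  have O1: "open O1" unfolding O1_def
    by (rule chart_open_image[OF P VP open_Int[OF chart_open(1)[OF P VP]
            open_vimage[OF chart_open(1)[OF A U] C_map_continuous[OF f]]]]) blast
  have f1: "f1 (t, \<psi> x) = \<phi> (F t x)" if "x \<in> V" for t x
    using that by (simp add: f1_def f_def prod_chart_inv[OF A V])
  have g1: "g1 (t, \<phi> y) = \<psi> (inv (F t) y)" if "y \<in> U" for t y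
    using that by (simp add: g1_def g_def prod_chart_inv[OF A U])
  have O1_iff: "z \<in> O1 \<longleftrightarrow> (\<exists>t x. x \<in> V \<and> F t x \<in> U \<and> z = (t, \<psi> x))" for z
    by (auto simp: O1_def f_def intro!: image_eqI)
  have S_iff: "z \<in> S \<longleftrightarrow> (\<exists>t y. y \<in> U \<and> inv (F t) y \<in> V \<and> z = (t, \<phi> y))" for z
    by (auto simp: S_def intro!: image_eqI)
  have image: "\<Phi> ` O1 = S"
  proof
    show "\<Phi> ` O1 \<subseteq> S"
    proof
      fix w assume "w \<in> \<Phi> ` O1"
      then obtain z where "z \<in> O1" "w = \<Phi> z" by blast
      then obtain t x where "x \<in> V" "F t x \<in> U" "w = \<Phi> (t, \<psi> x)" using O1_iff[of z] by blast
      then have "F t x \<in> U \<and> inv (F t) (F t x) \<in> V \<and> w = (t, \<phi> (F t x))"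
        by (simp add: \<Phi>_def f1 Finv)
      then show "w \<in> S" using S_iff[of w] by blast
    qed
    show "S \<subseteq> \<Phi> ` O1"
    proof
      fix w assume "w \<in> S"
      then obtain t y where y: "y \<in> U" "inv (F t) y \<in> V" "w = (t, \<phi> y)" using S_iff[of w] by blast
      then have "w = \<Phi> (t, \<psi> (inv (F t) y))" by (simp add: \<Phi>_def f1 Finv)
      moreover have "(t, \<psi> (inv (F t) y)) \<in> O1" using y O1_iff Finv by metis
      ultimately show "w \<in> \<Phi> ` O1" by blast
    qed
  qed
  have left_inverse: "\<Gamma> (\<Phi> z) = z" if "z \<in> O1" for z
    using that O1_iff by (auto simp: \<Phi>_def \<Gamma>_def f1 g1 Finv)
  have "C_nat_on O1 n f1"
    unfolding O1_def f1_def by (rule C_on_le[OF C_map_chart[OF f VP U] n])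
  then have C: "C_nat_on O1 n \<Phi>"
    unfolding \<Phi>_def by (rule C_nat_on_Pair[OF O1 C_nat_on_bounded_linear[OF O1 bounded_linear_fst]])
  \<comment> \<open>As \<open>\<Phi>\<close> preserves time, a kernel vector is of the form
    \<open>(0, w)\<close>; then \<open>w = 0\<close> because \<open>F t\<close> has a differentiable
    inverse.\<close>
  have inj: "v = 0" if z: "z \<in> O1" and der: "(\<Phi> has_derivative \<Phi>') (at z)" and v: "\<Phi>' v = 0" for z v \<Phi>'
  proof -
    obtain t x where x: "x \<in> V" "F t x \<in> U" "z = (t, \<psi> x)" using z O1_iff[of z] by blast
    have lin: "linear \<Phi>'" using der by (rule has_derivative_linear)
    have "((\<lambda>y. fst (\<Phi> y)) has_derivative (\<lambda>h. fst (\<Phi>' h))) (at z)"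
      by (rule has_derivative_fst[OF der])
    moreover have "((\<lambda>y. fst (\<Phi> y)) has_derivative fst) (at z)"
      unfolding \<Phi>_def by (simp add: has_derivative_fst[OF has_derivative_ident])
    ultimately have fst: "fst (\<Phi>' h) = fst h" for h
      using has_derivative_unique by metis
    then obtain w where w: "v = (0, w)" using v by (metis fst_zero prod.collapse)
    \<comment> \<open>The chart form of \<open>inv (F t)\<close>, differentiable because
      \<open>1 \<le> r\<close>. It undoes the space component of \<open>\<Phi>\<close> at time
      \<open>t\<close>, so the chain rule recovers \<open>w\<close> from the image of
      \<open>(0, w)\<close>.\<close>
    define k where "k = \<psi> \<circ> inv (F t) \<circ> inv_into U \<phi>"
    have "C_map r A A (inv (F t))" using diffeo by (simp add: C_diffeo_def)
    from C_map_chart[OF this U V] have "C_nat_on (\<phi> ` (U \<inter> inv (F t) -` V)) 1 k"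
      unfolding k_def by (rule C_on_le) (use r in \<open>simp add: one_enat_def\<close>)
    moreover have "F t x \<in> U \<inter> inv (F t) -` V" using x by (simp add: Finv)
    ultimately have "k differentiable (at (\<phi> (F t x)))" by simp
    then obtain k' where k': "(k has_derivative k') (at (\<phi> (F t x)))" by (auto simp: differentiable_def)
    have "((\<lambda>u. (t, u)) has_derivative (\<lambda>h. (0, h))) (at (\<psi> x))"
      by (intro has_derivative_Pair has_derivative_const has_derivative_ident)
    then have "((\<lambda>u. \<Phi> (t, u)) has_derivative (\<lambda>h. \<Phi>' (0, h))) (at (\<psi> x))"
      by (rule has_derivative_compose) (use der x in simp)
    then have "((\<lambda>u. snd (\<Phi> (t, u))) has_derivative (\<lambda>h. snd (\<Phi>' (0, h)))) (at (\<psi> x))"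
      by (rule has_derivative_snd)
    then have "((\<lambda>u. k (snd (\<Phi> (t, u)))) has_derivative (\<lambda>h. k' (snd (\<Phi>' (0, h))))) (at (\<psi> x))"
      by (rule has_derivative_compose) (use k' x in \<open>simp add: \<Phi>_def f1\<close>)
    moreover have "open {u. (t, u) \<in> O1}"
      using open_vimage[OF O1, of "\<lambda>u. (t, u)"] by (simp add: vimage_def continuous_intros)
    moreover have "\<psi> x \<in> {u. (t, u) \<in> O1}" using z x by simp
    moreover have "k (snd (\<Phi> (t, u))) = u" if "u \<in> {u. (t, u) \<in> O1}" for u
      using that O1_iff by (auto simp: \<Phi>_def f1 k_def chart_inv[OF A U] Finv)
    ultimately have "((\<lambda>u. u) has_derivative (\<lambda>h. k' (snd (\<Phi>' (0, h))))) (at (\<psi> x))"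
      by (rule has_derivative_transform_within_open)
    then have "(\<lambda>h. k' (snd (\<Phi>' (0, h)))) = (\<lambda>h. h)"
      using has_derivative_unique has_derivative_ident by blast
    then have "k' (snd (\<Phi>' (0, w))) = w" by metis
    moreover have "k' 0 = 0" using k' has_derivative_linear linear_0 by blast
    ultimately show "v = 0" using v w by (simp add: zero_prod_def)
  qed
  note inverse = C_nat_on_inverse[OF O1 C left_inverse inj, unfolded image]
  show op: "open S" by (rule inverse(1))
  have "C_nat_on S n (\<lambda>z. snd (\<Gamma> z))"
    by (rule C_nat_on_bounded_linear_compose[OF op bounded_linear_snd inverse(2)])
  then show "C_nat_on S n (\<psi> \<circ> (\<lambda>(t, y). inv (F t) y) \<circ> inv_into (UNIV \<times> U) (map_prod id \<phi>))"
    by (simp add: \<Gamma>_def g1_def g_def comp_def)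
qed

text \<open>Smoothness in charts is \<open>isotopy_inv_chart\<close>. \<open>C_map\<close> also asks
  for global continuity, which is read off from the same lemma with \<open>n = 0\<close> around each
  point.\<close>

lemma isotopy_inv:
  assumes A: "topological_atlas A" and r: "1 \<le> r" and F: "isotopy r A F"
  shows "isotopy r A (\<lambda>t. inv (F t))"
proof -
  let ?P = "prod_atlas (standard_atlas :: (real, real) atlas) A"
  define g where "g = (\<lambda>(t, y). inv (F t) y)"
  have "C_map r ?P A g"
  proof (rule C_mapI)
    have "continuous (at p) g" for p
    proof -
      obtain t y where p: "p = (t, y)" by (cases p)
      obtain U \<phi> where U: "(U, \<phi>) \<in> A" "y \<in> U" by (rule chart_at[OF A])
      obtain V \<psi> where V: "(V, \<psi>) \<in> A" "inv (F t) y \<in> V" by (rule chart_at[OF A])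
      define S where "S = map_prod id \<phi> ` (UNIV \<times> U \<inter> g -` V)"
      define g1 where "g1 = \<psi> \<circ> g \<circ> inv_into (UNIV \<times> U) (map_prod id \<phi>)"
      have n0: "enat 0 \<le> r" by (simp add: zero_enat_def[symmetric])
      note chart = isotopy_inv_chart[OF A r F U(1) V(1) n0, folded g_def, folded S_def]
      have S: "open S" by (rule chart(1))
      have cg1: "continuous_on S g1" using chart(2) by (simp add: g1_def)
      define N where "N = UNIV \<times> U \<inter> map_prod id \<phi> -` S"
      have c\<phi>: "continuous_on (UNIV \<times> U) (map_prod (id :: real \<Rightarrow> real) \<phi>)"
        unfolding map_prod_def case_prod_beta id_apply
        by (intro continuous_on_Pair continuous_on_fst continuous_on_id
            continuous_on_compose2[OF homeomorphism_cont1[OF chart_homeomorphism[OF A U(1)]]]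
            continuous_on_snd) auto
      have N: "open N" unfolding N_def
        by (rule continuous_open_preimage[OF c\<phi> open_Times[OF open_UNIV chart_open(1)[OF A U(1)]] S])
      have N_S: "map_prod id \<phi> ` N \<subseteq> S" by (auto simp: N_def)
      \<comment> \<open>Membership in \<open>S\<close> provides some \<open>x'\<close> with the same
        chart value as \<open>x\<close>; injectivity of \<open>\<phi>\<close> on \<open>U\<close>
        identifies the two.\<close>
      have N_V: "g z \<in> V" if "z \<in> N" for z
      proof -
        obtain s x where z: "z = (s, x)" by (cases z)
        have x: "x \<in> U" "(s, \<phi> x) \<in> S" using that by (auto simp: N_def z)
        then obtain x' where "x' \<in> U" "g (s, x') \<in> V" "\<phi> x' = \<phi> x" by (auto simp: S_def)
        then show ?thesis using x inj_onD[OF chart_inj_on[OF A U(1)]] z by metis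
      qed
      have "continuous_on N (\<lambda>z. g1 (map_prod id \<phi> z))"
        by (rule continuous_on_compose2[OF cg1 continuous_on_subset[OF c\<phi>] N_S]) (auto simp: N_def)
      moreover have g1: "g1 (map_prod id \<phi> z) = \<psi> (g z)" if "z \<in> N" for z
        using that by (cases z) (simp add: g1_def N_def prod_chart_inv[OF A U(1)])
      ultimately have "continuous_on N (\<lambda>z. inv_into V \<psi> (g1 (map_prod id \<phi> z)))"
        by (intro continuous_on_compose2[OF homeomorphism_cont2[OF chart_homeomorphism[OF A V(1)]]])
          (auto intro!: imageI N_V)
      then have "continuous_on N g"
        by (rule continuous_on_eq) (simp add: g1 chart_inv[OF A V(1)] N_V)
      moreover have "p \<in> N" using U V by (auto simp: N_def p S_def g_def intro!: image_eqI)
      ultimately show ?thesis using N continuous_on_eq_continuous_at by blast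
    qed
    then show "continuous_on UNIV g" by (simp add: continuous_at_imp_continuous_on)
    fix X :: "(real \<times> 'a) set" and \<xi> V \<psi> n
    assume X: "(X, \<xi>) \<in> ?P" and V: "(V, \<psi>) \<in> A" and n: "enat n \<le> r"
    obtain U \<phi> where U: "(U, \<phi>) \<in> A" and X: "X = UNIV \<times> U" "\<xi> = map_prod id \<phi>"
      using X unfolding prod_atlas_standard_iff by blast
    show "C_nat_on (\<xi> ` (X \<inter> g -` V)) n (\<psi> \<circ> g \<circ> inv_into X \<xi>)"
      unfolding X g_def by (rule isotopy_inv_chart(2)[OF A r F U V n])
  qed
  then show ?thesis using F by (simp add: isotopy_def g_def C_diffeo_inv inv_id)
qed

section \<open>Commutator groups of diffeomorphisms\<close>

lemma group_Diff:
  assumes "smooth_manifold A"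
  shows "group (Diff r A)"
proof (rule groupI)
  fix f assume f: "f \<in> carrier (Diff r A)"
  then have "inv f \<in> carrier (Diff r A)" by (simp add: Diff_def C_diffeo_inv)
  moreover have "inv f \<circ> f = id" using f by (simp add: Diff_def C_diffeo_def bij_is_inj)
  ultimately show "\<exists>g\<in>carrier (Diff r A). g \<otimes>\<^bsub>Diff r A\<^esub> f = \<one>\<^bsub>Diff r A\<^esub>"
    by (auto simp: Diff_def)
qed (use assms smooth_manifold_imp_topological_atlas[OF assms] in
    \<open>auto simp: Diff_def C_diffeo_id C_diffeo_comp comp_assoc\<close>)

lemma Diff_inv:
  assumes "smooth_manifold A" "C_diffeo r A f"
  shows "m_inv (Diff r A) f = inv f"
proof (rule group.inv_equality[OF group_Diff[OF assms(1)]])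
  show "inv f \<otimes>\<^bsub>Diff r A\<^esub> f = \<one>\<^bsub>Diff r A\<^esub>"
    using assms(2) by (simp add: Diff_def C_diffeo_def bij_is_inj)
qed (use assms(2) in \<open>simp_all add: Diff_def C_diffeo_inv\<close>)

lemma subgroup_Diff_homeo_group:
  assumes A: "smooth_manifold A" and H: "subgroup H (Diff r A)"
  shows "homeo_group H"
proof
  have diffeo: "C_diffeo r A f" if "f \<in> H" for f
    using subgroup.subset[OF H] that by (auto simp: Diff_def)
  show "id \<in> H" using subgroup.one_closed[OF H] by (simp add: Diff_def)
  show "f \<circ> g \<in> H" if "f \<in> H" "g \<in> H" for f g
    using subgroup.m_closed[OF H that] by (simp add: Diff_def)
  show "inv f \<in> H" if "f \<in> H" for f
    using subgroup.m_inv_closed[OF H that] Diff_inv[OF A diffeo[OF that]] by simp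
  show "bij f" "continuous_on UNIV f" if "f \<in> H" for f
    using diffeo[OF that] by (auto simp: C_diffeo_def dest: C_map_continuous)
qed

lemma simple_subgroup_Diff_iff:
  assumes A: "smooth_manifold A" and H: "subgroup H (Diff r A)"
  shows "simple ((Diff r A)\<lparr>carrier := H\<rparr>) \<longleftrightarrow>
    H \<noteq> {id} \<and> (\<forall>N. normal_in H N \<longrightarrow> N = H \<or> N = {id})"
proof -
  let ?K = "(Diff r A)\<lparr>carrier := H\<rparr>"
  interpret D: group "Diff r A" by (rule group_Diff[OF A])
  interpret K: group ?K by (rule D.subgroup_imp_group[OF H])
  interpret H: homeo_group H by (rule subgroup_Diff_homeo_group[OF A H])
  have inv: "m_inv ?K f = inv f" if "f \<in> H" for f
  proof (rule K.inv_equality)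
    show "inv f \<otimes>\<^bsub>?K\<^esub> f = \<one>\<^bsub>?K\<^esub>"
      using H.bij_mem[OF that] by (simp add: Diff_def bij_is_inj)
  qed (use that H.inv_mem in simp_all)
  have mult: "f \<otimes>\<^bsub>?K\<^esub> g = f \<circ> g" and one: "\<one>\<^bsub>?K\<^esub> = id" and car: "carrier ?K = H" for f g
    by (simp_all add: Diff_def)
  have sub: "subgroup N ?K \<longleftrightarrow> N \<subseteq> H \<and> id \<in> N \<and> (\<forall>f\<in>N. \<forall>g\<in>N. f \<circ> g \<in> N) \<and> (\<forall>f\<in>N. inv f \<in> N)" for N
    unfolding subgroup_def car mult one using inv by (metis subsetD)
  have "N \<lhd> ?K \<longleftrightarrow> normal_in H N" for N
    unfolding K.normal_inv_iff sub normal_in_def car mult using inv by auto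
  then show ?thesis unfolding simple_def car one using K.is_group by simp
qed

text \<open>Induction over the generated subgroup. An inverse of a generator is again a commutator,
  so closure of \<open>K\<close> under composition is enough.\<close>

lemma derived_Diff_minimal:
  assumes A: "smooth_manifold A" and G: "subgroup G (Diff r A)"
    and K: "id \<in> K" "\<And>f g. f \<in> K \<Longrightarrow> g \<in> K \<Longrightarrow> f \<circ> g \<in> K"
      "\<And>f g. f \<in> G \<Longrightarrow> g \<in> G \<Longrightarrow> commutator f g \<in> K"
  shows "derived (Diff r A) G \<subseteq> K"
proof
  interpret G: homeo_group G by (rule subgroup_Diff_homeo_group[OF A G])
  have diffeo: "C_diffeo r A f" if "f \<in> G" for f
    using subgroup.subset[OF G] that by (auto simp: Diff_def)
  have set: "derived_set (Diff r A) G = {commutator f g |f g. f \<in> G \<and> g \<in> G}"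
  proof -
    have "f \<otimes>\<^bsub>Diff r A\<^esub> g \<otimes>\<^bsub>Diff r A\<^esub> m_inv (Diff r A) f \<otimes>\<^bsub>Diff r A\<^esub> m_inv (Diff r A) g = commutator f g"
      if "f \<in> G" "g \<in> G" for f g
      using Diff_inv[OF A diffeo[OF that(1)]] Diff_inv[OF A diffeo[OF that(2)]]
      by (simp add: Diff_def commutator_def)
    then show ?thesis by auto
  qed
  fix d assume "d \<in> derived (Diff r A) G"
  then have "d \<in> generate (Diff r A) {commutator f g |f g. f \<in> G \<and> g \<in> G}"
    unfolding derived_def set .
  then show "d \<in> K"
  proof induction
    case one
    have "\<one>\<^bsub>Diff r A\<^esub> = id" by (simp add: Diff_def)
    then show ?case using K(1) by (simp only:)
  next
    case (incl h)
    then show ?case using K(3) by blast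
  next
    case (inv h)
    then obtain f g where fg: "f \<in> G" "g \<in> G" "h = commutator f g" by blast
    have "m_inv (Diff r A) h = commutator g f"
      unfolding Diff_inv[OF A diffeo[OF G.commutator_mem[OF fg(1,2)]]] fg(3)
      by (rule G.inv_commutator[OF fg(1,2)])
    then show ?case using K(3) fg by simp
  next
    case (eng h1 h2)
    have "h1 \<otimes>\<^bsub>Diff r A\<^esub> h2 = h1 \<circ> h2" by (simp add: Diff_def)
    then show ?case using K(2)[OF eng.IH] by (simp only:)
  qed
qed

lemma commutator_in_derived_Diff:
  assumes A: "smooth_manifold A" and G: "subgroup G (Diff r A)" and fg: "f \<in> G" "g \<in> G"
  shows "commutator f g \<in> derived (Diff r A) G"
proof -
  have diffeo: "C_diffeo r A f" if "f \<in> G" for f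
    using subgroup.subset[OF G] that by (auto simp: Diff_def)
  have "commutator f g =
      f \<otimes>\<^bsub>Diff r A\<^esub> g \<otimes>\<^bsub>Diff r A\<^esub> m_inv (Diff r A) f \<otimes>\<^bsub>Diff r A\<^esub> m_inv (Diff r A) g"
    unfolding Diff_inv[OF A diffeo[OF fg(1)]] Diff_inv[OF A diffeo[OF fg(2)]]
    by (simp add: Diff_def commutator_def)
  then show ?thesis unfolding derived_def using fg by (intro generate.incl) blast
qed

text \<open>The pointwise commutator of two isotopies in \<open>G\<close> is an isotopy in the
  commutator group. The endpoints of such isotopies are closed under composition, so minimality
  applies.\<close>

lemma isotopically_connected_derived:
  assumes A: "smooth_manifold A" and r: "1 \<le> r" and G: "subgroup G (Diff r A)"
    and conn: "isotopically_connected r A G"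
  shows "isotopically_connected r A (derived (Diff r A) G)"
proof -
  let ?D = "derived (Diff r A) G"
  note A' = smooth_manifold_imp_topological_atlas[OF A]
  have GD: "G \<subseteq> carrier (Diff r A)" by (rule subgroup.subset[OF G])
  interpret D: homeo_group ?D
    by (rule subgroup_Diff_homeo_group[OF A group.derived_is_subgroup[OF group_Diff[OF A] GD]])
  define K where "K = {d. \<exists>F. isotopy_in r A ?D F \<and> F 1 = d}"
  have comm: "commutator f g \<in> K" if fg: "f \<in> G" "g \<in> G" for f g
  proof -
    obtain F where F: "isotopy_in r A G F" "F 1 = f"
      using conn fg(1) by (auto simp: isotopically_connected_def)
    obtain H where H: "isotopy_in r A G H" "H 1 = g"
      using conn fg(2) by (auto simp: isotopically_connected_def)
    have "isotopy r A (\<lambda>t. F t \<circ> H t \<circ> inv (F t) \<circ> inv (H t))"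
      using F H by (intro isotopy_comp[OF A'] isotopy_inv[OF A' r]) (auto simp: isotopy_in_def)
    moreover have "commutator (F t) (H t) \<in> ?D" for t
      using F H by (intro commutator_in_derived_Diff[OF A G]) (auto simp: isotopy_in_def)
    ultimately have "isotopy_in r A ?D (\<lambda>t. commutator (F t) (H t))"
      by (simp add: isotopy_in_def commutator_def)
    then show ?thesis using F(2) H(2) by (auto simp: K_def)
  qed
  have "?D \<subseteq> K"
  proof (rule derived_Diff_minimal[OF A G _ _ comm])
    \<comment> \<open>The identity is reached as the commutator of \<open>id\<close> with
      itself.\<close>
    have "id \<in> G" using subgroup.one_closed[OF G] by (simp add: Diff_def)
    from comm[OF this this] show "id \<in> K" by (simp add: commutator_def)
    fix f g assume "f \<in> K" "g \<in> K"
    then obtain F H where F: "isotopy_in r A ?D F" "F 1 = f" and H: "isotopy_in r A ?D H" "H 1 = g"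
      by (auto simp: K_def)
    have "isotopy_in r A ?D (\<lambda>t. F t \<circ> H t)"
      using F H isotopy_comp[OF A'] D.comp_mem by (simp add: isotopy_in_def)
    then show "f \<circ> g \<in> K" using F H by (auto simp: K_def)
  qed
  then show ?thesis by (auto simp: isotopically_connected_def K_def)
qed

text \<open>Such an \<open>H\<close> is its own maximal isotopically connected subgroup. Accessible
  points lie in the orbit since isotopies in \<open>H\<close> consist of members of
  \<open>H\<close>; conversely each \<open>h\<close> is the time-one map of an isotopy in
  \<open>H\<close>.\<close>

lemma foliation_of_isotopically_connected:
  assumes A: "smooth_manifold A" and H: "subgroup H (Diff r A)" "isotopically_connected r A H"
  shows "foliation r A H = range (\<lambda>x. (\<lambda>h. h x) ` H)"
proof -
  interpret H: homeo_group H by (rule subgroup_Diff_homeo_group[OF A H(1)])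
  have "maximal_isotopically_connected r A H = H"
    unfolding maximal_isotopically_connected_def by (rule Greatest_equality) (use H in auto)
  moreover have "accessible r A H x = (\<lambda>h. h x) ` H" for x
  proof
    show "accessible r A H x \<subseteq> (\<lambda>h. h x) ` H"
    proof
      fix z assume "z \<in> accessible r A H x"
      then show "z \<in> (\<lambda>h. h x) ` H"
      proof induction
        case start
        then show ?case using H.id_mem by (metis id_apply imageI)
      next
        case (forward y F t)
        then obtain h where h: "h \<in> H" "y = h x" by blast
        then have "F t \<circ> h \<in> H" using forward(2) by (intro H.comp_mem) (auto simp: isotopy_in_def)
        then show ?case using h by (metis comp_apply imageI)
      next
        case (backward y F t)
        then obtain h where h: "h \<in> H" "y = h x" by blast
        then have "inv (F t) \<circ> h \<in> H"
          using backward(2) by (intro H.comp_mem H.inv_mem) (auto simp: isotopy_in_def)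
        then show ?case using h by (metis comp_apply imageI)
      qed
    qed
    show "(\<lambda>h. h x) ` H \<subseteq> accessible r A H x"
    proof
      fix z assume "z \<in> (\<lambda>h. h x) ` H"
      then obtain h where h: "h \<in> H" "z = h x" by blast
      then obtain F where F: "isotopy_in r A H F" "F 1 = h"
        using H(2) by (auto simp: isotopically_connected_def)
      show "z \<in> accessible r A H x"
        using accessible.forward[OF accessible.start F(1), of 1 x] F(2) h(2) by simp
    qed
  qed
  ultimately show ?thesis by (simp add: foliation_def)
qed

text \<open>The path of \<open>x\<close> under an isotopy to \<open>g\<close> is connected and
  contains two distinct points, which is impossible inside a finite subset of a Hausdorff
  space.\<close>

lemma infinite_orbit:
  fixes A :: "('m::t2_space, 'e::euclidean_space) atlas"
  assumes conn: "isotopically_connected r A G" and g: "g \<in> G" "g x \<noteq> x"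
  shows "infinite ((\<lambda>g. g x) ` G)"
proof
  assume fin: "finite ((\<lambda>g. g x) ` G)"
  obtain F where F: "isotopy r A F" "\<And>t. F t \<in> G" "F 1 = g"
    using conn g(1) by (auto simp: isotopically_connected_def isotopy_in_def)
  have "continuous_on UNIV (\<lambda>(t, x). F t x)" using F(1) by (simp add: isotopy_def C_map_def)
  from continuous_on_compose2[OF this, of UNIV "\<lambda>t. (t, x)"]
  have "continuous_on UNIV (\<lambda>t. F t x)" by (simp add: continuous_intros)
  then have con: "connected (range (\<lambda>t. F t x))" by (rule connected_continuous_image) simp
  have "range (\<lambda>t. F t x) \<subseteq> (\<lambda>g. g x) ` G" using F(2) by blast
  then have "finite (range (\<lambda>t. F t x))" using fin finite_subset by blast
  \<comment> \<open>A finite path would split into the disjoint closed sets \<open>{x}\<close> and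
    the rest, both nonempty.\<close>
  then have "closed (range (\<lambda>t. F t x) - {x})" by (intro finite_imp_closed) simp
  from connected_closedD[OF con _ _ closed_singleton this]
  have "{x} \<inter> range (\<lambda>t. F t x) = {} \<or> (range (\<lambda>t. F t x) - {x}) \<inter> range (\<lambda>t. F t x) = {}"
    by blast
  moreover have "F 0 x = x" "F 1 x \<noteq> x" using F g(2) by (auto simp: isotopy_def)
  then have "x \<in> range (\<lambda>t. F t x)" "F 1 x \<in> range (\<lambda>t. F t x) - {x}" by (metis rangeI, simp)
  ultimately show False by blast
qed

theorem theorem1p1:
  fixes A :: "('m::t2_space, 'e::euclidean_space) atlas"
    and r :: enat
    and G :: "('m \<Rightarrow> 'm) set"
  assumes "smooth_manifold A"
    and "paracompact_space (euclidean :: 'm topology)"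
    and "1 \<le> r"
    and "subgroup G (Diff r A)"
    and "G \<subseteq> Diff_c_0 r A"
    and "isotopically_connected r A G"
    and "non_fixing G"
    and "factorizable r A G"
  shows "simple ((Diff r A)\<lparr>carrier := derived (Diff r A) G\<rparr>) \<longleftrightarrow>
           no_proper_minimal_set (foliation r A (derived (Diff r A) G))"
proof -
  let ?D = "derived (Diff r A) G"
  note A = assms(1) and G = assms(4)
  interpret Diff: group "Diff r A" by (rule group_Diff[OF A])
  have D: "subgroup ?D (Diff r A)"
    by (rule Diff.derived_is_subgroup[OF subgroup.subset[OF G]])
  interpret G: homeo_group G by (rule subgroup_Diff_homeo_group[OF A G])
  have moves: "\<exists>g\<in>G. g x \<noteq> x" for x
  proof (rule ccontr)
    assume "\<not> ?thesis"
    then have "(\<lambda>g. g x) ` G \<subseteq> {x}" by auto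
    moreover have "x \<in> (\<lambda>g. g x) ` G" using imageI[OF G.id_mem, of "\<lambda>g. g x"] by simp
    ultimately have "(\<lambda>g. g x) ` G = {x}" by blast
    then show False using assms(7) by (simp add: non_fixing_def)
  qed
  interpret factorizable_homeo_group G ?D
  proof (rule factorizable_homeo_group.intro[OF G.homeo_group_axioms],
      rule factorizable_homeo_group_axioms.intro)
    show "\<exists>g\<in>G. g x \<noteq> x" for x by (rule moves)
    show "homeo_group ?D" by (rule subgroup_Diff_homeo_group[OF A D])
    show "?D \<subseteq> G" by (rule Diff.derived_incl[OF order_refl G])
    show "commutator f g \<in> ?D" if "f \<in> G" "g \<in> G" for f g
      by (rule commutator_in_derived_Diff[OF A G that])
    show "?D \<subseteq> K" if "id \<in> K" "\<And>f g. f \<in> K \<Longrightarrow> g \<in> K \<Longrightarrow> f \<circ> g \<in> K"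
      "\<And>f g. f \<in> G \<Longrightarrow> g \<in> G \<Longrightarrow> commutator f g \<in> K" for K
      by (rule derived_Diff_minimal[OF A G that])
    fix \<U> :: "'m set set" and g
    assume \<U>: "\<And>U. U \<in> \<U> \<Longrightarrow> open U" "\<Union>\<U> = UNIV" and g: "g \<in> G"
    have "\<exists>gs. g = foldr (\<circ>) gs id \<and>
        (\<forall>h\<in>set gs. h \<in> G \<and> (\<exists>U\<in>\<U>. h \<in> supported_component r A G U))"
      using assms(8) \<U> g unfolding factorizable_def by simp
    then obtain gs where gs: "g = foldr (\<circ>) gs id"
      "\<forall>h\<in>set gs. h \<in> G \<and> (\<exists>U\<in>\<U>. h \<in> supported_component r A G U)" by blast
    \<comment> \<open>The time-one map of an isotopy in \<open>G\<close> with supports in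
      \<open>U\<close> is itself supported in \<open>U\<close>.\<close>
    have "supported_in h U" if "h \<in> supported_component r A G U" for h U
      using that closure_subset[of "{x. h x \<noteq> x}"]
      by (auto simp: supported_component_def identity_component_def isotopy_in_def supp_def
          supported_in_def)
    then have "\<forall>h\<in>set gs. h \<in> G \<and> (\<exists>U\<in>\<U>. supported_in h U)" using gs(2) by blast
    with gs(1) show "\<exists>gs. g = foldr (\<circ>) gs id \<and> (\<forall>h\<in>set gs. h \<in> G \<and> (\<exists>U\<in>\<U>. supported_in h U))"
      by blast
  qed
  have nontrivial: "?D \<noteq> {id}"
  proof -
    \<comment> \<open>Here \<open>undefined\<close> is just some point of the manifold, whose type
      is inhabited.\<close>
    obtain d where "d \<in> ?D" "d undefined \<noteq> undefined" by (rule D_moves)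
    then show ?thesis by auto
  qed
  have orbit: "infinite ((\<lambda>g. g x) ` G)" for x
    using moves[of x] infinite_orbit[OF assms(6)] by blast
  have "simple ((Diff r A)\<lparr>carrier := ?D\<rparr>) \<longleftrightarrow> (\<forall>N. normal_in ?D N \<longrightarrow> N = ?D \<or> N = {id})"
    using simple_subgroup_Diff_iff[OF A D] nontrivial by simp
  also have "\<dots> \<longleftrightarrow> (\<forall>x. closure ((\<lambda>d. d x) ` ?D) = UNIV)"
    using dense_orbit_of_simple simple_of_dense_orbits[OF assms(2) orbit] by blast
  also have "\<dots> \<longleftrightarrow> no_proper_minimal_set (foliation r A ?D)"
    unfolding no_proper_minimal_set_def
      foliation_of_isotopically_connected[OF A D isotopically_connected_derived[OF A assms(3) G assms(6)]]
    by simp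
  finally show ?thesis .
qed

end
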